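(* Let $d\geqslant2$ and let $\alpha$ be a mixing Noetherian entropy rank one $\mathbb{Z}^d$-action by continuous automorphisms of a compact metrizable abelian zero-dimensional group $X$, with dual $R_d$-module $M$. Then for every $\varepsilon>0$, the set $\{\mathsf{F}_\alpha(\Lambda):\Lambda\in\mathcal{L}_d(\mathbb{P}(\alpha),\varepsilon)\}$ is finite.
   Context: $R_d=\mathbb{Z}[u_1^{\pm1},\dots,u_d^{\pm1}]$; $M=\widehat{X}$ is an $R_d$-module with $u^{\mathbf{n}}$ acting as the dual of $\alpha^{\mathbf{n}}$; Noetherian means $M$ is a Noetherian $R_d$-module; entropy rank one means each $\alpha^{\mathbf{n}}$ has finite topological entropy; mixing is with respect to Haar measure. $\mathcal{L}_d$ is the set of finite-index subgroups of $\mathbb{Z}^d$, $[\Lambda]=|\mathbb{Z}^d/\Lambda|$, $\mathsf{F}_\alpha(\Lambda)$ the number of points fixed by all $\alpha^{\mathbf{n}}$, $\mathbf{n}\in\Lambda$. $\mathbb{P}$ is the set of rational primes, $\mathbb{P}(\alpha)=\{p\in\mathbb{P}: p\in\mathfrak{p}\text{ for some associated prime }\mathfrak{p}\in\operatorname{Ass}(M)\}$. For primes $p\neq q$, $m_p(q)$ is the multiplicative order of $p$ modulo $q$. For a finite set $P\subset\mathbb{P}$ and $\varepsilon>0$, $\mathcal{L}_d(P,\varepsilon)=\{\Lambda\in\mathcal{L}_d: [\Lambda]\in\mathbb{P}\setminus P \text{ and } m_p([\Lambda])>[\Lambda]^{\frac1d+\varepsilon}\text{ for all }p\in P\}$. 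*)

theory Defs
  imports "HOL-Probability.Probability" "HOL-Number_Theory.Number_Theory" "HOL-Library.Function_Algebras"
begin

(* Z^d is modelled as 'd \<Rightarrow> int with 'd a finite index type, d = CARD('d).
   A Z^d-action on X is alpha :: ('d \<Rightarrow> int) \<Rightarrow> 'x \<Rightarrow> 'x. *)

definition zd_action :: "(('d::finite \<Rightarrow> int) \<Rightarrow> 'x \<Rightarrow> 'x) \<Rightarrow> bool" where
  "zd_action \<alpha> \<longleftrightarrow> \<alpha> 0 = id \<and> (\<forall>m n. \<alpha> (m + n) = \<alpha> m \<circ> \<alpha> n)"

definition by_cont_automorphisms ::
  "(('d::finite \<Rightarrow> int) \<Rightarrow> 'x::{topological_space, ab_group_add} \<Rightarrow> 'x) \<Rightarrow> bool" where
  "by_cont_automorphisms \<alpha> \<longleftrightarrow>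
     (\<forall>n. continuous_on UNIV (\<alpha> n) \<and> bij (\<alpha> n) \<and> (\<forall>x y. \<alpha> n (x + y) = \<alpha> n x + \<alpha> n y))"

definition zero_dimensional :: "'x::topological_space itself \<Rightarrow> bool" where
  "zero_dimensional _ \<longleftrightarrow>
     (\<forall>U x. open U \<longrightarrow> x \<in> (U :: 'x set) \<longrightarrow> (\<exists>V. open V \<and> closed V \<and> x \<in> V \<and> V \<subseteq> U))"

definition haar_measure :: "'x::{topological_space, ab_group_add} measure \<Rightarrow> bool" where
  "haar_measure \<mu> \<longleftrightarrow> sets \<mu> = sets borel \<and> prob_space \<mu> \<and>
     (\<forall>a A. A \<in> sets borel \<longrightarrow> emeasure \<mu> ((\<lambda>x. a + x) ` A) = emeasure \<mu> A)"

definition mixing :: "'x measure \<Rightarrow> (('d::finite \<Rightarrow> int) \<Rightarrow> 'x \<Rightarrow> 'x) \<Rightarrow> bool" where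
  "mixing \<mu> \<alpha> \<longleftrightarrow> (\<forall>A \<in> sets \<mu>. \<forall>B \<in> sets \<mu>.
     ((\<lambda>n. measure \<mu> (A \<inter> \<alpha> n -` B)) \<longlongrightarrow> measure \<mu> A * measure \<mu> B) cofinite)"

definition separated :: "('x::metric_space \<Rightarrow> 'x) \<Rightarrow> nat \<Rightarrow> real \<Rightarrow> 'x set \<Rightarrow> bool" where
  "separated T n \<epsilon> E \<longleftrightarrow>
     (\<forall>x\<in>E. \<forall>y\<in>E. x \<noteq> y \<longrightarrow> (\<exists>k<n. dist ((T ^^ k) x) ((T ^^ k) y) > \<epsilon>))"

definition sepnum :: "('x::metric_space \<Rightarrow> 'x) \<Rightarrow> nat \<Rightarrow> real \<Rightarrow> nat" where
  "sepnum T n \<epsilon> = Sup {card E | E. finite E \<and> separated T n \<epsilon> E}"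

definition top_entropy :: "('x::metric_space \<Rightarrow> 'x) \<Rightarrow> ereal" where
  "top_entropy T = (SUP \<epsilon>\<in>{0<..}. limsup (\<lambda>n. ereal (ln (real (sepnum T n \<epsilon>)) / real n)))"

definition entropy_rank_one :: "(('d::finite \<Rightarrow> int) \<Rightarrow> 'x::metric_space \<Rightarrow> 'x) \<Rightarrow> bool" where
  "entropy_rank_one \<alpha> \<longleftrightarrow> (\<forall>n. top_entropy (\<alpha> n) < \<infinity>)"

definition dual_group :: "('x::{topological_space, ab_group_add} \<Rightarrow> complex) set" where
  "dual_group = {chi. continuous_on UNIV chi \<and> (\<forall>x y. chi (x + y) = chi x * chi y) \<and> (\<forall>x. cmod (chi x) = 1)}"

(* Elements of R_d = Z[u_1^{\<pm>1},...,u_d^{\<pm>1}] as finitely supported coefficient functions Z^d \<rightarrow> Z *)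
definition finsupp :: "(('d::finite \<Rightarrow> int) \<Rightarrow> int) \<Rightarrow> bool" where
  "finsupp f \<longleftrightarrow> finite {n. f n \<noteq> 0}"

definition Rd_one :: "('d::finite \<Rightarrow> int) \<Rightarrow> int" where
  "Rd_one = (\<lambda>n. if n = 0 then 1 else 0)"

definition Rd_const :: "int \<Rightarrow> ('d::finite \<Rightarrow> int) \<Rightarrow> int" where
  "Rd_const c = (\<lambda>n. if n = 0 then c else 0)"

definition Rd_mult :: "(('d::finite \<Rightarrow> int) \<Rightarrow> int) \<Rightarrow> (('d \<Rightarrow> int) \<Rightarrow> int) \<Rightarrow> ('d \<Rightarrow> int) \<Rightarrow> int" where
  "Rd_mult f g = (\<lambda>n. \<Sum>a\<in>{a. f a \<noteq> 0}. f a * g (n - a))"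

(* module action of R_d on M: u^n acts as the dual of alpha^n, i.e. chi \<mapsto> chi \<circ> alpha^n *)
definition Rd_act :: "(('d::finite \<Rightarrow> int) \<Rightarrow> 'x \<Rightarrow> 'x) \<Rightarrow> (('d \<Rightarrow> int) \<Rightarrow> int) \<Rightarrow> ('x \<Rightarrow> complex) \<Rightarrow> 'x \<Rightarrow> complex" where
  "Rd_act \<alpha> f chi = (\<lambda>x. \<Prod>n\<in>{n. f n \<noteq> 0}. chi (\<alpha> n x) powi f n)"

definition submodule :: "(('d::finite \<Rightarrow> int) \<Rightarrow> 'x \<Rightarrow> 'x) \<Rightarrow> ('x::{topological_space, ab_group_add} \<Rightarrow> complex) set \<Rightarrow> bool" where
  "submodule \<alpha> N \<longleftrightarrow> N \<subseteq> dual_group \<and> (\<lambda>_. 1) \<in> N \<and>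
     (\<forall>chi\<in>N. \<forall>psi\<in>N. (\<lambda>x. chi x * psi x) \<in> N) \<and>
     (\<forall>chi\<in>N. \<forall>f. finsupp f \<longrightarrow> Rd_act \<alpha> f chi \<in> N)"

definition noetherian :: "(('d::finite \<Rightarrow> int) \<Rightarrow> 'x::{topological_space, ab_group_add} \<Rightarrow> 'x) \<Rightarrow> bool" where
  "noetherian \<alpha> \<longleftrightarrow> (\<forall>N :: nat \<Rightarrow> ('x \<Rightarrow> complex) set.
     (\<forall>i. submodule \<alpha> (N i)) \<and> mono N \<longrightarrow> (\<exists>k. \<forall>i\<ge>k. N i = N k))"

definition annihilator :: "(('d::finite \<Rightarrow> int) \<Rightarrow> 'x \<Rightarrow> 'x) \<Rightarrow> ('x \<Rightarrow> complex) \<Rightarrow> (('d \<Rightarrow> int) \<Rightarrow> int) set" where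
  "annihilator \<alpha> chi = {f. finsupp f \<and> Rd_act \<alpha> f chi = (\<lambda>_. 1)}"

definition prime_ideal_Rd :: "(('d::finite \<Rightarrow> int) \<Rightarrow> int) set \<Rightarrow> bool" where
  "prime_ideal_Rd P \<longleftrightarrow> Rd_one \<notin> P \<and>
     (\<forall>f g. finsupp f \<longrightarrow> finsupp g \<longrightarrow> Rd_mult f g \<in> P \<longrightarrow> f \<in> P \<or> g \<in> P)"

definition Ass :: "(('d::finite \<Rightarrow> int) \<Rightarrow> 'x::{topological_space, ab_group_add} \<Rightarrow> 'x) \<Rightarrow> (('d \<Rightarrow> int) \<Rightarrow> int) set set" where
  "Ass \<alpha> = {annihilator \<alpha> chi | chi. chi \<in> dual_group \<and> prime_ideal_Rd (annihilator \<alpha> chi)}"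

definition primes_of :: "(('d::finite \<Rightarrow> int) \<Rightarrow> 'x::{topological_space, ab_group_add} \<Rightarrow> 'x) \<Rightarrow> nat set" where
  "primes_of \<alpha> = {p. prime p \<and> (\<exists>\<PP>\<in>Ass \<alpha>. Rd_const (int p) \<in> \<PP>)}"

definition Zd_subgroup :: "('d::finite \<Rightarrow> int) set \<Rightarrow> bool" where
  "Zd_subgroup L \<longleftrightarrow> 0 \<in> L \<and> (\<forall>a\<in>L. \<forall>b\<in>L. a - b \<in> L)"

definition Zd_cosets :: "('d::finite \<Rightarrow> int) set \<Rightarrow> ('d \<Rightarrow> int) set set" where
  "Zd_cosets L = (\<lambda>v. (\<lambda>w. v + w) ` L) ` UNIV"

definition finite_index_subgroups :: "('d::finite \<Rightarrow> int) set set" where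
  "finite_index_subgroups = {L. Zd_subgroup L \<and> finite (Zd_cosets L)}"

definition idx :: "('d::finite \<Rightarrow> int) set \<Rightarrow> nat" where
  "idx L = card (Zd_cosets L)"

definition fixcount :: "(('d::finite \<Rightarrow> int) \<Rightarrow> 'x \<Rightarrow> 'x) \<Rightarrow> ('d \<Rightarrow> int) set \<Rightarrow> enat" where
  "fixcount \<alpha> L = (let F = {x. \<forall>n\<in>L. \<alpha> n x = x} in if finite F then enat (card F) else \<infinity>)"

definition Ld_P_eps :: "nat set \<Rightarrow> real \<Rightarrow> ('d::finite \<Rightarrow> int) set set" where
  "Ld_P_eps P \<epsilon> = {L \<in> finite_index_subgroups. prime (idx L) \<and> idx L \<notin> P \<and>
      (\<forall>p\<in>P. real (ord (idx L) p) > real (idx L) powr (1 / real CARD('d) + \<epsilon>))}"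

end

(* The dual M of X is a finitely generated torsion R_d-module.  Finite entropy of the coordinate
   automorphisms forces, for every element of M and every pair of variables, a monic polynomial
   relation in these two variables; hence all but linearly many monomials in a box of side R are
   reducible, and the part M_R of M spanned by the box of side R satisfies log |M_R| = O(R).
   By mixing, u^n - 1 is injective on M for n <> 0, so comparing M_R with M_(R+|n|) shows that M/(u^n - 1)M,
   the dual of the group of points fixed by alpha^n, has at most exp(C |n|) elements.
   A subgroup Lambda of prime index q contains some n <> 0 with |n| <= q^(1/d).  If a point is
   fixed by Lambda but not by Z^d, then Z^d/Lambda acts nontrivially on the p-primary part of
   that finite quotient for some p in P(alpha), and counting orbits modulo q gives
   m_p(q) <= C' q^(1/d).  This contradicts m_p(q) > q^(1/d + eps) for large q.  So for all but
   finitely many Lambda the Lambda-fixed points are exactly the Z^d-fixed points. *)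

theory Submission
  imports Defs "HOL-Algebra.Sylow"
begin

section \<open>Abelian groups as modules over the integers\<close>

text \<open>Extracting a monic relation from finite entropy requires inverting a leading
  coefficient, which works modulo a prime; elements of prime order are therefore treated directly
  and all others by induction on their order. Relations in every pair of variables suffice because
  two large exponents already make a monomial divisible by a leading one, so the surviving monomials
  lie near the coordinate axes, whatever d is. The finite quotient is realised concretely by
  restricting characters to the Lambda-fixed points, where the image of u^n - 1 becomes trivial. If
  A restrictions come from the box of side R, injectivity of u^n - 1 multiplies the size of a larger
  box by at least A at each enlargement by |n|; the t-th root of A^t <= exp(C(R + t|n| + 1)) forgets
  R. The orbit count compares the p-primary part, of order p^a, with its fixed subgroup, of order
  p^b: q divides p^a - p^b, and since q is not in P(alpha), p^b cancels and m_p(q) divides a -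
  b.\<close>

definition zmul :: "int \<Rightarrow> 'a::ab_group_add \<Rightarrow> 'a" where
  "zmul k a = (\<Sum>i<nat k. a) - (\<Sum>i<nat (- k). a)"

lemma sum_const_add: "(\<Sum>i<m + n :: nat. a) = (\<Sum>i<m. a) + (\<Sum>i<n. (a::'a::ab_group_add))"
  by (induction n) (auto simp: algebra_simps)

text \<open>In the definition one of the two sums is always empty. Allowing any representation of
  the integer as a difference turns additivity in the scalar into a rearrangement of sums.\<close>

lemma zmul_int_diff: "zmul (int m - int n) a = (\<Sum>i<m. a) - (\<Sum>i<n. a)"
proof (cases "n \<le> m")
  case True
  then obtain d where "m = n + d" using le_Suc_ex by blast
  then show ?thesis by (simp add: zmul_def sum_const_add)
next
  case False
  then obtain d where "n = m + d" using le_Suc_ex by (metis nat_le_linear)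
  then show ?thesis by (simp add: zmul_def sum_const_add)
qed

lemma zmul_of_nat: "zmul (int n) a = (\<Sum>i<n. a)"
  using zmul_int_diff[of n 0 a] by simp

lemma zmul_of_nat_Suc: "zmul (int (Suc n)) a = a + zmul (int n) a"
  by (simp add: zmul_of_nat del: of_nat_Suc)

lemma zmul_add_left: "zmul (k + l) a = zmul k a + zmul l a"
proof -
  obtain m n where k: "k = int m - int n" by (rule int_diff_cases)
  obtain m' n' where l: "l = int m' - int n'" by (rule int_diff_cases)
  have "k + l = int (m + m') - int (n + n')" by (simp add: k l)
  then show ?thesis
    by (simp only: zmul_int_diff sum_const_add k l) (simp add: algebra_simps)
qed

lemma zmul_add_right: "zmul k (a + b) = zmul k a + zmul k b"
  by (simp add: zmul_def sum.distrib algebra_simps)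

lemma zmul_one: "zmul 1 a = a"
  using zmul_of_nat[of 1 a] by simp

lemma zmul_zero_left: "zmul 0 a = 0"
  by (simp add: zmul_def)

lemma zmul_minus_left: "zmul (- k) a = - zmul k a"
  by (metis add.right_inverse minus_unique zmul_add_left zmul_zero_left)

lemma zmul_mult: "zmul (k * l) a = zmul k (zmul l a)"
proof (induction k rule: int_induct[where k=0])
  case base
  then show ?case by (simp add: zmul_zero_left)
next
  case (step1 i)
  then show ?case by (simp add: distrib_right zmul_add_left zmul_one)
next
  case (step2 i)
  then show ?case
    using zmul_add_left[of "i * l" "- l" a] zmul_add_left[of i "-1" "zmul l a"]
    by (simp add: left_diff_distrib zmul_minus_left zmul_one)
qed

global_interpretation zm: Modules.module "zmul :: int \<Rightarrow> 'a::ab_group_add \<Rightarrow> 'a"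
  by unfold_locales (auto simp: zmul_add_left zmul_add_right zmul_mult zmul_one)

abbreviation zspan :: "'a::ab_group_add set \<Rightarrow> 'a set" where
  "zspan \<equiv> zm.span"

text \<open>Integer multiples are iterated sums, so the subgroup test already gives a submodule over
  the integers.\<close>

lemma zm_subspace_diffI:
  assumes "0 \<in> S" "\<And>a b. a \<in> S \<Longrightarrow> b \<in> S \<Longrightarrow> a - b \<in> S"
  shows "zm.subspace S"
proof (rule zm.subspaceI)
  have neg: "- a \<in> S" if "a \<in> S" for a using assms(2)[OF assms(1) that] by simp
  show add: "a + b \<in> S" if "a \<in> S" "b \<in> S" for a b
    using assms(2)[OF that(1) neg[OF that(2)]] by simp
  have nat: "zmul (int n) a \<in> S" if "a \<in> S" for n a
  proof (induction n)
    case 0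
    then show ?case using assms(1) by simp
  next
    case (Suc n)
    then show ?case using add[OF that Suc] by (simp only: zmul_of_nat_Suc)
  qed
  show "zmul c a \<in> S" if "a \<in> S" for c a
  proof (cases c)
    case (nonneg n)
    then show ?thesis using nat that by simp
  next
    case (neg n)
    then show ?thesis using nat[OF that] \<open>\<And>a. a \<in> S \<Longrightarrow> - a \<in> S\<close> by (metis zmul_minus_left)
  qed
qed (rule assms)

locale additive_map =
  fixes f :: "'a::ab_group_add \<Rightarrow> 'b::ab_group_add"
  assumes add: "f (a + b) = f a + f b"
begin

sublocale additive f by unfold_locales (rule add)

lemma zmul: "f (zmul k a) = zmul k (f a)"
  by (simp add: zmul_def diff sum)

lemma span_image: "x \<in> zspan S \<Longrightarrow> f x \<in> zspan (f ` S)"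
proof (induction rule: zm.span_induct_alt)
  case base
  then show ?case by (simp add: zero zm.span_zero)
next
  case (step c x y)
  then show ?case by (simp add: add zmul zm.span_add zm.span_scale zm.span_base)
qed

end

text \<open>The same combination of the undivided elements serves as \<open>y\<close>. This lifts a
  relation for a multiple of an element to the element itself, up to a defect killed by that
  multiple.\<close>

lemma zspan_zmul_image:
  assumes "x \<in> zspan ((\<lambda>i. zmul n (g i)) ` I)"
  obtains y where "y \<in> zspan (g ` I)" "x = zmul n y"
proof -
  have "\<exists>y. y \<in> zspan (g ` I) \<and> x = zmul n y" using assms
  proof (induction rule: zm.span_induct_alt)
    case base
    then show ?case by (intro exI[of _ 0]) (simp add: zm.span_zero)
  next
    case (step c x y)
    then obtain i z where i: "i \<in> I" "x = zmul n (g i)" and z: "z \<in> zspan (g ` I)" "y = zmul n z"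
      by auto
    show ?case
      by (rule exI[of _ "zmul c (g i) + z"])
         (simp add: i z zm.span_add zm.span_scale zm.span_base zm.scale_right_distrib mult.commute)
  qed
  then show thesis using that by blast
qed

text \<open>Coefficients matter only modulo \<open>N\<close>, which leaves \<open>N ^ card S\<close>
  coefficient vectors.\<close>

lemma card_zspan_le:
  assumes "finite S" "N > 0" "\<And>a. a \<in> S \<Longrightarrow> zmul (int N) a = 0"
  shows "finite (zspan S) \<and> card (zspan S) \<le> N ^ card S"
proof -
  let ?F = "S \<rightarrow>\<^sub>E {0..<int N}"
  let ?h = "\<lambda>u. \<Sum>v\<in>S. zmul (u v) v"
  have "zspan S \<subseteq> ?h ` ?F"
  proof
    fix x assume "x \<in> zspan S"
    then obtain u where x: "x = (\<Sum>v\<in>S. zmul (u v) v)"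
      using zm.span_finite[OF assms(1)] by auto
    have "zmul (u v) v = zmul (u v mod int N) v" if "v \<in> S" for v
    proof -
      have "u v = u v mod int N + u v div int N * int N" by simp
      then have "zmul (u v) v = zmul (u v mod int N) v + zmul (u v div int N) (zmul (int N) v)"
        by (metis zmul_add_left zmul_mult)
      then show ?thesis using assms(3)[OF that] by simp
    qed
    then have "x = ?h (restrict (\<lambda>v. u v mod int N) S)" by (simp add: x)
    moreover have "restrict (\<lambda>v. u v mod int N) S \<in> ?F"
      using assms(2) by (simp add: restrict_PiE_iff)
    ultimately show "x \<in> ?h ` ?F" by blast
  qed
  moreover have "finite ?F" "card ?F = N ^ card S"
    using assms(1) by (auto simp: finite_PiE card_PiE)
  ultimately show ?thesis
    by (metis (no_types, lifting) card_image_le card_mono finite_imageI finite_subset le_trans)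
qed

section \<open>Monomials and their weights\<close>

definition coord_prime :: "'d::finite \<Rightarrow> nat" where
  "coord_prime = (SOME f. inj f \<and> (\<forall>i. prime (f i)))"

lemma inj_coord_prime: "inj (coord_prime :: 'd::finite \<Rightarrow> nat)" and prime_coord_prime: "prime (coord_prime (i::'d))"
proof -
  obtain T :: "nat set" where T: "T \<subseteq> {p. prime p}" "finite T" "card T = CARD('d)"
    using infinite_arbitrarily_large[OF primes_infinite] by blast
  then obtain f :: "'d \<Rightarrow> nat" where "bij_betw f UNIV T"
    using finite_same_card_bij[of "UNIV::'d set" T] by auto
  then have "inj f \<and> (\<forall>i. prime (f i))"
    using T(1) by (auto simp: bij_betw_def)
  then have "inj (coord_prime :: 'd \<Rightarrow> nat) \<and> (\<forall>i::'d. prime (coord_prime i))"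
    unfolding coord_prime_def by (rule someI[of "\<lambda>f. inj f \<and> (\<forall>i. prime (f i))"])
  then show "inj (coord_prime :: 'd \<Rightarrow> nat)" "prime (coord_prime (i::'d))" by auto
qed

text \<open>Distinct primes make the weight injective (unique factorization), so comparing weights is a total
  well-founded monomial order that is compatible with multiplication.\<close>

definition weight :: "('d::finite \<Rightarrow> nat) \<Rightarrow> nat" where
  "weight m = (\<Prod>i\<in>UNIV. coord_prime i ^ m i)"

lemma weight_add: "weight (m + n) = weight m * weight n"
  by (simp add: weight_def power_add prod.distrib)

lemma weight_pos: "weight m > 0"
  by (simp add: weight_def prod_pos prime_gt_0_nat[OF prime_coord_prime])

lemma weight_inj: "weight m = weight n \<Longrightarrow> m = (n :: 'd::finite \<Rightarrow> nat)"
proof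
  fix i :: 'd assume eq: "weight m = weight n"
  have "multiplicity (coord_prime i) (weight k) = k i" for k :: "'d \<Rightarrow> nat"
  proof -
    have "weight k = (\<Prod>p\<in>range (coord_prime :: 'd \<Rightarrow> nat). p ^ k (inv_into UNIV coord_prime p))"
      by (simp add: weight_def prod.reindex inj_coord_prime inv_into_f_f[OF inj_coord_prime])
    moreover have "multiplicity (coord_prime i) (\<Prod>p\<in>range (coord_prime :: 'd \<Rightarrow> nat). p ^ k (inv_into UNIV coord_prime p)) = k (inv_into UNIV coord_prime (coord_prime i))"
      by (subst multiplicity_prod_prime_powers) (auto simp: prime_coord_prime)
    ultimately show ?thesis by (simp add: inv_into_f_f[OF inj_coord_prime])
  qed
  then show "m i = n i" using eq by metis
qed

text \<open>Together with \<open>weight_bounded\<close> this shows that the weight order distorts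
  exponents only linearly: the logarithm of the weight is a positive linear form in the
  exponents.\<close>

lemma weight_ge: "2 ^ m i \<le> weight (m :: 'd::finite \<Rightarrow> nat)"
proof -
  have "(2::nat) ^ m i \<le> coord_prime i ^ m i"
    by (simp add: power_mono prime_ge_2_nat prime_coord_prime)
  also have "\<dots> \<le> (\<Prod>i\<in>UNIV. coord_prime i ^ m i)"
    by (rule dvd_imp_le) (auto simp: prod_pos prime_gt_0_nat prime_coord_prime)
  finally show ?thesis by (simp add: weight_def)
qed

lemma weight_bounded: "(\<And>i. m i \<le> R) \<Longrightarrow> weight (m :: 'd::finite \<Rightarrow> nat) \<le> weight (\<lambda>_::'d. 1::nat) ^ R"
proof -
  assume *: "\<And>i. m i \<le> R"
  have "weight m \<le> (\<Prod>i\<in>UNIV. coord_prime (i::'d) ^ R)"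
    unfolding weight_def by (intro prod_mono) (auto intro!: power_increasing * simp: prime_ge_1_nat[OF prime_coord_prime, simplified])
  also have "\<dots> = weight (\<lambda>_::'d. 1::nat) ^ R"
    by (simp add: weight_def prod_power_distrib)
  finally show ?thesis .
qed

text \<open>A union of one long thin box per coordinate axis covers the set. The point is that the
  count is linear in \<open>L\<close>.\<close>

lemma card_one_unbounded_coordinate:
  assumes "D > 0"
  shows "finite {s :: 'd::finite \<Rightarrow> nat. (\<exists>i. \<forall>j. j \<noteq> i \<longrightarrow> s j < D) \<and> (\<forall>i. s i \<le> L)}"
    and "card {s :: 'd::finite \<Rightarrow> nat. (\<exists>i. \<forall>j. j \<noteq> i \<longrightarrow> s j < D) \<and> (\<forall>i. s i \<le> L)}
      \<le> CARD('d) * D ^ CARD('d) * (L + 1)"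
proof -
  let ?B = "\<lambda>i. Pi\<^sub>E (UNIV::'d set) (\<lambda>j. if j = i then {..L} else {..<D})"
  have card: "card (?B i) \<le> D ^ CARD('d) * (L + 1)" for i
  proof -
    have "card (?B i) = (\<Prod>j\<in>UNIV. card (if j = i then {..L} else {..<D}))"
      by (simp add: card_PiE)
    also have "\<dots> = (L + 1) * (\<Prod>j\<in>UNIV-{i}. card (if j = i then {..L} else {..<D}))"
      by (subst prod.remove[of _ i]) auto
    also have "(\<Prod>j\<in>UNIV-{i}. card (if j = i then {..L} else {..<D})) = D ^ (CARD('d) - 1)"
      by simp
    finally have "card (?B i) = D ^ (CARD('d) - 1) * (L + 1)" by simp
    moreover have "D ^ (CARD('d) - 1) \<le> D ^ CARD('d)" using assms by (intro power_increasing) auto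
    ultimately show ?thesis by (simp only: mult_le_mono1)
  qed
  have fin: "finite (\<Union>i. ?B i)" by (auto intro!: finite_PiE)
  have sub: "{s :: 'd \<Rightarrow> nat. (\<exists>i. \<forall>j. j \<noteq> i \<longrightarrow> s j < D) \<and> (\<forall>i. s i \<le> L)} \<subseteq> (\<Union>i. ?B i)"
  proof safe
    fix s :: "'d \<Rightarrow> nat" and i assume "\<forall>j. j \<noteq> i \<longrightarrow> s j < D" "\<forall>i. s i \<le> L"
    then have "s \<in> ?B i" by (simp add: PiE_iff)
    then show "s \<in> (\<Union>i. ?B i)" by blast
  qed
  show "finite {s :: 'd \<Rightarrow> nat. (\<exists>i. \<forall>j. j \<noteq> i \<longrightarrow> s j < D) \<and> (\<forall>i. s i \<le> L)}"
    using fin sub by (rule finite_subset[rotated])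
  have "card (\<Union>i. ?B i) \<le> (\<Sum>i\<in>UNIV. card (?B i))" by (rule card_UN_le) simp
  also have "\<dots> \<le> (\<Sum>i\<in>(UNIV::'d set). D ^ CARD('d) * (L + 1))" by (intro sum_mono card)
  finally show "card {s :: 'd \<Rightarrow> nat. (\<exists>i. \<forall>j. j \<noteq> i \<longrightarrow> s j < D) \<and> (\<forall>i. s i \<le> L)}
      \<le> CARD('d) * D ^ CARD('d) * (L + 1)"
    using card_mono[OF fin sub] by (simp add: algebra_simps)
qed

section \<open>Linear growth of Laurent polynomial modules\<close>

locale zd_module =
  fixes u :: "('d::finite \<Rightarrow> int) \<Rightarrow> 'm::ab_group_add \<Rightarrow> 'm"
  assumes u_0: "u 0 a = a"
    and u_plus: "u (m + n) a = u m (u n a)"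
    and u_add: "u n (a + b) = u n a + u n b"
begin

sublocale u: additive_map "u n" for n
  by unfold_locales (rule u_add)

lemma u_minus_cancel: "u (- n) (u n a) = a" "u n (u (- n) a) = a"
  using u_plus[of "- n" n a] u_plus[of n "- n" a] by (auto simp: u_0)

lemma u_commute: "u m (u n a) = u n (u m a)"
  by (metis add.commute u_plus)

text \<open>The weight order is well-founded only on nonnegative exponents, so reduction is carried
  out with these operators; Laurent monomials are shifted into this range later.\<close>

definition U :: "('d \<Rightarrow> nat) \<Rightarrow> 'm \<Rightarrow> 'm" where
  "U m = u (\<lambda>i. int (m i))"

sublocale U: additive_map "U n" for n
  by unfold_locales (simp add: U_def u_add)

lemma U_plus: "U (m + n) a = U m (U n a)"
proof -
  have "(\<lambda>i. int ((m + n) i)) = (\<lambda>i. int (m i)) + (\<lambda>i. int (n i))" by auto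
  then show ?thesis by (simp only: U_def u_plus)
qed

section \<open>Leading monomials and normal forms\<close>

definition low :: "('d \<Rightarrow> nat) \<Rightarrow> 'm \<Rightarrow> 'm set" where
  "low m0 a = zspan ((\<lambda>m. U m a) ` {m. weight m < weight m0})"

text \<open>A relation for \<open>a\<close> with leading monomial \<open>m0\<close> and leading
  coefficient 1, so that reduction by it requires no division.\<close>

definition reducible :: "('d \<Rightarrow> nat) \<Rightarrow> 'm \<Rightarrow> bool" where
  "reducible m0 a \<longleftrightarrow> U m0 a \<in> low m0 a"

lemma subspace_low: "zm.subspace (low m a)"
  by (simp add: low_def)

lemma low_mono: "weight m \<le> weight n \<Longrightarrow> low m a \<subseteq> low n a"
  unfolding low_def by (intro zm.span_mono image_mono) auto

lemma U_low: "x \<in> low m a \<Longrightarrow> U k x \<in> low (k + m) a"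
proof -
  assume "x \<in> low m a"
  then have "U k x \<in> zspan (U k ` (\<lambda>m. U m a) ` {n. weight n < weight m})"
    unfolding low_def by (rule U.span_image)
  moreover have "U k ` (\<lambda>m. U m a) ` {n. weight n < weight m} \<subseteq> (\<lambda>m. U m a) ` {n. weight n < weight (k + m)}"
  proof safe
    fix n :: "'d \<Rightarrow> nat" assume "weight n < weight m"
    then show "U k (U n a) \<in> (\<lambda>m. U m a) ` {n. weight n < weight (k + m)}"
      by (intro image_eqI[of _ _ "k + n"]) (auto simp: U_plus weight_add weight_pos)
  qed
  ultimately show ?thesis unfolding low_def using zm.span_mono by blast
qed

text \<open>Relations compose like a product of monic polynomials: if the first one leaves the
  defect \<open>U m1 a - x\<close> and the second one kills this defect, the product has leading
  monomial \<open>m1 + m2\<close>.\<close>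

lemma reducible_add:
  assumes x: "x \<in> low m1 a" and red: "reducible m2 (U m1 a - x)"
  shows "reducible (m1 + m2) a"
proof -
  let ?b = "U m1 a - x" and ?L = "low (m1 + m2) a"
  have "low m2 ?b \<subseteq> ?L"
    unfolding low_def[of m2]
  proof (rule zm.span_minimal[OF _ subspace_low], safe)
    fix m :: "'d \<Rightarrow> nat" assume m: "weight m < weight m2"
    have "weight (m + m1) < weight (m1 + m2)" using m by (simp only: weight_add mult.commute[of "weight m"]) (simp add: weight_pos)
    then have "U (m + m1) a \<in> ?L"
      unfolding low_def by (intro zm.span_base imageI) blast
    moreover have "U m x \<in> ?L"
      using U_low[OF x, of m] low_mono[of "m + m1" "m1 + m2" a] m by (auto simp: weight_add weight_pos)
    ultimately show "U m ?b \<in> ?L"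
      by (simp add: U.diff U_plus zm.subspace_diff subspace_low)
  qed
  then have "U m2 ?b \<in> ?L" using red by (auto simp: reducible_def)
  moreover have "U m2 x \<in> ?L" using U_low[OF x, of m2] by (simp add: add.commute)
  moreover have "U (m1 + m2) a = U m2 ?b + U m2 x"
    by (subst add.commute) (simp add: U.diff U_plus)
  ultimately show ?thesis by (simp add: reducible_def zm.subspace_add subspace_low)
qed

text \<open>Induction on the order of the element: a relation for a multiple of prime order is lifted, and
  its defect has smaller order.\<close>

lemma reducible_exists:
  assumes rel: "\<And>p b. prime p \<Longrightarrow> zmul (int p) b = 0 \<Longrightarrow>
      \<exists>m. (\<forall>k. k \<noteq> i \<and> k \<noteq> j \<longrightarrow> m k = 0) \<and> reducible m b"
    and "n > 0" "zmul (int n) a = 0"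
  shows "\<exists>m. (\<forall>k. k \<noteq> i \<and> k \<noteq> j \<longrightarrow> m k = 0) \<and> reducible m a"
  using assms(2-)
proof (induction n arbitrary: a rule: less_induct)
  case (less n)
  show ?case
  proof (cases "n = 1")
    case True
    then have "reducible 0 a" using less.prems
      by (simp add: zmul_one reducible_def U.zero low_def zm.span_zero)
    then show ?thesis by (intro exI[of _ 0]) (simp add: zero_fun_def)
  next
    case False
    then obtain p where p: "prime p" "p dvd n" using prime_factor_nat by blast
    then obtain k where k: "n = p * k" by blast
    then have k0: "0 < k" "k < n" using less.prems p prime_gt_1_nat[of p] by auto
    have "zmul (int p) (zmul (int k) a) = 0"
      using less.prems by (simp add: k)
    from rel[OF p(1) this] obtain m1
      where m1: "\<forall>l. l \<noteq> i \<and> l \<noteq> j \<longrightarrow> m1 l = 0" "reducible m1 (zmul (int k) a)" by blast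
    then have "U m1 (zmul (int k) a) \<in> zspan ((\<lambda>m. zmul (int k) (U m a)) ` {m. weight m < weight m1})"
      by (simp add: reducible_def low_def U.zmul)
    then obtain y where y: "y \<in> low m1 a" "U m1 (zmul (int k) a) = zmul (int k) y"
      unfolding low_def by (rule zspan_zmul_image)
    have "zmul (int k) (U m1 a - y) = 0"
      using y(2) by (simp add: zm.scale_right_diff_distrib U.zmul)
    from less.IH[OF k0(2,1) this] obtain m2
      where m2: "\<forall>l. l \<noteq> i \<and> l \<noteq> j \<longrightarrow> m2 l = 0" "reducible m2 (U m1 a - y)" by blast
    have "reducible (m1 + m2) a" using reducible_add[OF y(1) m2(2)] .
    moreover have "\<forall>l. l \<noteq> i \<and> l \<noteq> j \<longrightarrow> (m1 + m2) l = 0" using m1(1) m2(1) by simp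
    ultimately show ?thesis by blast
  qed
qed

text \<open>Division by the leading monomials: a monomial divisible by one of them is rewritten in
  monomials of smaller weight, and descent of the weight ends the process.\<close>

lemma standard_monomials_span:
  assumes "\<And>m. m \<in> M \<Longrightarrow> reducible m a"
  shows "U m a \<in> zspan ((\<lambda>s. U s a) ` {s. weight s \<le> weight m \<and> (\<forall>m0\<in>M. \<not> m0 \<le> s)})"
proof (induction "weight m" arbitrary: m rule: less_induct)
  case less
  let ?S = "\<lambda>m. (\<lambda>s. U s a) ` {s. weight s \<le> weight m \<and> (\<forall>m0\<in>M. \<not> m0 \<le> s)}"
  show ?case
  proof (cases "\<exists>m0\<in>M. m0 \<le> m")
    case False
    then show ?thesis by (intro zm.span_base imageI) auto
  next
    case True
    then obtain m0 where m0: "m0 \<in> M" "m0 \<le> m" by blast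
    define k where "k = (\<lambda>i. m i - m0 i)"
    have m: "m = k + m0" using m0(2) by (auto simp: k_def le_fun_def)
    have "U m a \<in> low m a"
      using assms[OF m0(1)] U_low[of _ m0 a k] by (simp add: reducible_def m U_plus)
    also have "low m a \<subseteq> zspan (?S m)"
      unfolding low_def
    proof (rule zm.span_minimal, safe)
      fix n :: "'d \<Rightarrow> nat" assume "weight n < weight m"
      with less have "U n a \<in> zspan (?S n)" by blast
      also have "\<dots> \<subseteq> zspan (?S m)"
        using \<open>weight n < weight m\<close> by (intro zm.span_mono image_mono) auto
      finally show "U n a \<in> zspan (?S m)" .
    qed
    finally show ?thesis .
  qed
qed

text \<open>A monomial divisible by none of the leading monomials of the pairwise relations has at most one
  exponent that is not below the common bound \<open>D\<close>.\<close>

lemma cyclic_linear_growth: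
  assumes rel: "\<And>i j. i \<noteq> j \<Longrightarrow> \<exists>m. (\<forall>k. k \<noteq> i \<and> k \<noteq> j \<longrightarrow> m k = 0) \<and> reducible m a"
  shows "\<exists>C. \<forall>R. \<exists>T. finite T \<and> card T \<le> C * (R + 1) \<and>
    (\<forall>m. (\<forall>i. m i \<le> R) \<longrightarrow> U m a \<in> zspan ((\<lambda>s. U s a) ` T))"
proof -
  from rel obtain M where M: "\<And>i j k. i \<noteq> j \<Longrightarrow> k \<noteq> i \<Longrightarrow> k \<noteq> j \<Longrightarrow> M i j k = 0"
      "\<And>i j. i \<noteq> j \<Longrightarrow> reducible (M i j) a" by metis
  \<comment> \<open>The successor makes every exponent of every chosen leading monomial strictly
    smaller than \<open>D\<close>.\<close>
  define D where "D = Suc (Max (range (\<lambda>(i,j,k). M i j k)))"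
  have D: "M i j k < D" for i j k
    unfolding D_def less_Suc_eq_le by (rule Max_ge) (auto intro!: image_eqI[of _ _ "(i,j,k)"])
  define Q where "Q = weight (\<lambda>_::'d. 1::nat)"
  define C where "C = CARD('d) * D ^ CARD('d) * (Q + 1)"
  have "\<exists>T. finite T \<and> card T \<le> C * (R + 1) \<and>
    (\<forall>m. (\<forall>i. m i \<le> R) \<longrightarrow> U m a \<in> zspan ((\<lambda>s. U s a) ` T))" for R
  proof -
    let ?T = "{s :: 'd \<Rightarrow> nat. (\<exists>i. \<forall>j. j \<noteq> i \<longrightarrow> s j < D) \<and> (\<forall>i. s i \<le> Q * R)}"
    have "D > 0" by (simp add: D_def)
    note T = card_one_unbounded_coordinate[OF this, where ?'d = 'd and L = "Q * R"]
    have "card ?T \<le> C * (R + 1)"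
    proof -
      have "CARD('d) * D ^ CARD('d) * (Q * R + 1) \<le> CARD('d) * D ^ CARD('d) * ((Q + 1) * (R + 1))"
        by (intro mult_left_mono) auto
      then show ?thesis unfolding C_def mult.assoc using T(2)[unfolded mult.assoc] by (rule order.trans[rotated])
    qed
    moreover have "U m a \<in> zspan ((\<lambda>s. U s a) ` ?T)" if m: "\<forall>i. m i \<le> R" for m
    proof -
      have "{s. weight s \<le> weight m \<and> (\<forall>m0\<in>{M i j | i j. i \<noteq> j}. \<not> m0 \<le> s)} \<subseteq> ?T"
      proof safe
        fix s i assume s: "weight s \<le> weight m" "\<forall>m0\<in>{M i j | i j. i \<noteq> j}. \<not> m0 \<le> s"
        have "2 ^ s i \<le> weight s" by (rule weight_ge)
        also have "\<dots> \<le> Q ^ R" using s(1) weight_bounded[of m R] m by (simp add: Q_def)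
        \<comment> \<open>Enlarging Q to 2^Q leaves powers of 2 on both sides, so that the weight
          bound becomes a bound on the exponent.\<close>
        also have "\<dots> \<le> (2 ^ Q) ^ R" by (intro power_mono) (auto simp: less_imp_le)
        finally have "(2::nat) ^ s i \<le> 2 ^ (Q * R)" by (simp add: power_mult)
        then show "s i \<le> Q * R" by simp
      next
        fix s assume s: "\<forall>m0\<in>{M i j | i j. i \<noteq> j}. \<not> m0 \<le> s"
        show "\<exists>i. \<forall>j. j \<noteq> i \<longrightarrow> s j < D"
        proof (rule ccontr)
          assume *: "\<not> (\<exists>i. \<forall>j. j \<noteq> i \<longrightarrow> s j < D)"
          then obtain i where i: "s i \<ge> D" by (meson not_le)
          from * obtain j where j: "j \<noteq> i" "s j \<ge> D" by (meson not_le)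
          have "M i j \<le> s"
            unfolding le_fun_def
          proof
            fix k
            show "M i j k \<le> s k"
              using M(1)[of i j k] D[of i j k] i j by (cases "k = i"; cases "k = j") auto
          qed
          then show False using s j(1) by blast
        qed
      qed
      then have "zspan ((\<lambda>s. U s a) ` {s. weight s \<le> weight m \<and> (\<forall>m0\<in>{M i j | i j. i \<noteq> j}. \<not> m0 \<le> s)})
          \<subseteq> zspan ((\<lambda>s. U s a) ` ?T)"
        by (intro zm.span_mono image_mono)
      moreover have "U m a \<in> zspan ((\<lambda>s. U s a) ` {s. weight s \<le> weight m \<and> (\<forall>m0\<in>{M i j | i j. i \<noteq> j}. \<not> m0 \<le> s)})"
        by (rule standard_monomials_span) (use M(2) in blast)
      ultimately show ?thesis by (rule subsetD)
    qed
    ultimately show ?thesis using T(1) by blast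
  qed
  then show ?thesis by blast
qed

section \<open>Linear growth for finitely many generators\<close>

definition box :: "'m set \<Rightarrow> nat \<Rightarrow> 'm set" where
  "box S R = zspan {u v a | v a. a \<in> S \<and> (\<forall>i. \<bar>v i\<bar> \<le> int R)}"

lemma box_linear_growth:
  assumes rel: "\<And>a i j. a \<in> S \<Longrightarrow> i \<noteq> j \<Longrightarrow> \<exists>m. (\<forall>k. k \<noteq> i \<and> k \<noteq> j \<longrightarrow> m k = 0) \<and> reducible m a"
    and "finite S" "N > 0" and kill: "\<And>a. a \<in> S \<Longrightarrow> zmul (int N) a = 0"
  shows "\<exists>C. \<forall>R. finite (box S R) \<and> card (box S R) \<le> N ^ (C * (R + 1))"
proof -
  have "\<forall>a\<in>S. \<exists>C. \<forall>R. \<exists>T. finite T \<and> card T \<le> C * (R + 1) \<and>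
      (\<forall>m. (\<forall>i. m i \<le> R) \<longrightarrow> U m a \<in> zspan ((\<lambda>s. U s a) ` T))"
    by (intro ballI cyclic_linear_growth rel)
  then obtain C where "\<forall>a\<in>S. \<forall>R. \<exists>T. finite T \<and> card T \<le> C a * (R + 1) \<and>
      (\<forall>m. (\<forall>i. m i \<le> R) \<longrightarrow> U m a \<in> zspan ((\<lambda>s. U s a) ` T))"
    by (rule bchoice[THEN exE])
  then have "\<forall>p\<in>S \<times> UNIV. \<exists>T. finite T \<and> card T \<le> C (fst p) * (snd p + 1) \<and>
      (\<forall>m. (\<forall>i. m i \<le> snd p) \<longrightarrow> U m (fst p) \<in> zspan ((\<lambda>s. U s (fst p)) ` T))"
    by auto
  then obtain T' where T': "\<forall>p\<in>S \<times> UNIV. finite (T' p) \<and> card (T' p) \<le> C (fst p) * (snd p + 1) \<and>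
      (\<forall>m. (\<forall>i. m i \<le> snd p) \<longrightarrow> U m (fst p) \<in> zspan ((\<lambda>s. U s (fst p)) ` T' p))"
    by (rule bchoice[THEN exE])
  define T where "T a R = T' (a, R)" for a R
  have CT: "\<And>a R. a \<in> S \<Longrightarrow> finite (T a R)" "\<And>a R. a \<in> S \<Longrightarrow> card (T a R) \<le> C a * (R + 1)"
     "\<And>a R m. a \<in> S \<Longrightarrow> (\<And>i. m i \<le> R) \<Longrightarrow> U m a \<in> zspan ((\<lambda>s. U s a) ` T a R)"
    using T' by (auto simp: T_def)
  have "finite (box S R) \<and> card (box S R) \<le> N ^ (2 * sum C S * (R + 1))" for R
  proof -
    define G where "G = (\<Union>a\<in>S. (\<lambda>s. U s a) ` T a (2 * R))"
    have finG: "finite G" using CT(1) assms(2) by (auto simp: G_def)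
    have "card G \<le> (\<Sum>a\<in>S. card ((\<lambda>s. U s a) ` T a (2 * R)))"
      unfolding G_def by (rule card_UN_le) (rule assms)
    also have "\<dots> \<le> (\<Sum>a\<in>S. C a * (2 * R + 1))"
      by (intro sum_mono order.trans[OF card_image_le] CT)
    also have "\<dots> \<le> 2 * sum C S * (R + 1)"
      by (simp only: sum_distrib_right[symmetric]) (simp add: algebra_simps)
    finally have cardG: "card G \<le> 2 * sum C S * (R + 1)" .
    have "zmul (int N) g = 0" if "g \<in> G" for g
      using that kill U.zmul[symmetric, of "int N"] U.zero by (auto simp: G_def)
    from card_zspan_le[OF finG assms(3) this]
    have zG: "finite (zspan G)" "card (zspan G) \<le> N ^ card G" by auto
    \<comment> \<open>Multiplication by u^(R, ..., R) moves the exponents from [-R, R] to [0, 2R],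
      where the bound for the operators \<open>U\<close> applies; this is the origin of the factor
      2.\<close>
    have "box S R \<subseteq> u (\<lambda>_. - int R) ` zspan G"
    proof
      fix x assume "x \<in> box S R"
      then have "u (\<lambda>_. int R) x \<in> zspan (u (\<lambda>_. int R) ` {u v a | v a. a \<in> S \<and> (\<forall>i. \<bar>v i\<bar> \<le> int R)})"
        unfolding box_def by (rule u.span_image)
      also have "\<dots> \<subseteq> zspan G"
      proof (rule zm.span_minimal, safe)
        fix v :: "'d \<Rightarrow> int" and a assume a: "a \<in> S" and v: "\<forall>i. \<bar>v i\<bar> \<le> int R"
        define m where "m = (\<lambda>i. nat (int R + v i))"
        have "int (m i) = int R + v i" for i using v[rule_format, of i] by (simp add: m_def)
        then have "(\<lambda>i. int (m i)) = (\<lambda>_. int R) + v" by auto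
        then have "u (\<lambda>_. int R) (u v a) = U m a" by (simp only: U_def u_plus)
        moreover have "m i \<le> 2 * R" for i using v[rule_format, of i] by (simp add: m_def)
        then have "U m a \<in> zspan ((\<lambda>s. U s a) ` T a (2 * R))" using CT(3)[OF a] by blast
        ultimately show "u (\<lambda>_. int R) (u v a) \<in> zspan G"
          using zm.span_mono[of "(\<lambda>s. U s a) ` T a (2 * R)" G] a by (auto simp: G_def)
      qed
      finally have "u (\<lambda>_. int R) x \<in> zspan G" .
      moreover have "- (\<lambda>_::'d. int R) = (\<lambda>_. - int R)" by auto
      then have "x = u (\<lambda>_. - int R) (u (\<lambda>_. int R) x)"
        using u_minus_cancel(1)[of "\<lambda>_. int R" x] by simp
      ultimately show "x \<in> u (\<lambda>_. - int R) ` zspan G" by blast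
    qed
    then have "finite (box S R)" "card (box S R) \<le> card (zspan G)"
      using zG(1) by (auto intro: finite_subset surj_card_le)
    moreover have "N ^ card G \<le> N ^ (2 * sum C S * (R + 1))"
      using cardG assms(3) by (intro power_increasing) auto
    ultimately show ?thesis using zG(2) by linarith
  qed
  then show ?thesis by blast
qed

end

section \<open>The dual of a compact zero-dimensional group\<close>

text \<open>The tube lemma, applied to the preimage of \<open>V\<close> under addition.\<close>

lemma open_translates_in:
  fixes C V :: "'x::{topological_space, topological_monoid_add} set"
  assumes "compact C" "open V"
  shows "open {w. \<forall>v\<in>C. w + v \<in> V}"
proof (subst open_subopen, safe)
  fix w assume w: "\<forall>v\<in>C. w + v \<in> V"
  have "open ((\<lambda>p. fst p + snd p) -` V)"
    by (rule open_vimage[OF assms(2)]) (auto intro!: continuous_intros)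
  moreover have "{w} \<times> C \<subseteq> (\<lambda>p. fst p + snd p) -` V" using w by auto
  ultimately have "\<exists>X. w \<in> X \<and> open X \<and> X \<times> C \<subseteq> (\<lambda>p. fst p + snd p) -` V"
    by (rule Elementary_Topology.tube_lemma[OF assms(1)])
  then obtain X where "w \<in> X" "open X" "X \<times> C \<subseteq> (\<lambda>p. fst p + snd p) -` V" by blast
  then show "\<exists>T. open T \<and> w \<in> T \<and> T \<subseteq> {w. \<forall>v\<in>C. w + v \<in> V}"
    by (intro exI[of _ X]) auto
qed

text \<open>The translation stabilizer of a clopen neighbourhood of 0 does the job.\<close>

lemma open_subgroup_exists:
  fixes A :: "'x::{topological_space, ab_group_add, topological_group_add} set"
  assumes comp: "compact (UNIV :: 'x set)" and zd: "zero_dimensional TYPE('x)"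
    and A: "open A" "0 \<in> A"
  obtains H where "open H" "zm.subspace H" "H \<subseteq> A"
proof -
  obtain V where V: "open V" "closed V" "0 \<in> V" "V \<subseteq> A"
    using zd A unfolding zero_dimensional_def by blast
  define H where "H = {w. \<forall>v. v \<in> V \<longleftrightarrow> w + v \<in> V}"
  \<comment> \<open>Both \<open>V\<close> and its complement are compact and open, so the stabilizer
    is an intersection of two sets of the form just shown to be open.\<close>
  have "H = {w. \<forall>v\<in>V. w + v \<in> V} \<inter> {w. \<forall>v\<in>-V. w + v \<in> -V}"
    by (auto simp: H_def)
  moreover have "compact V" "compact (- V)"
    using compact_Int_closed[OF comp, of V] compact_Int_closed[OF comp, of "- V"] V(1,2) by auto
  ultimately have "open H"
    using V(1,2) by (simp only: open_Int open_translates_in open_Compl)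
  moreover have "zm.subspace H"
  proof (rule zm_subspace_diffI)
    show "0 \<in> H" by (simp add: H_def)
    fix a b assume ab: "a \<in> H" "b \<in> H"
    have "v \<in> V \<longleftrightarrow> a - b + v \<in> V" for v
    proof -
      have "- b + v \<in> V \<longleftrightarrow> b + (- b + v) \<in> V" "- b + v \<in> V \<longleftrightarrow> a + (- b + v) \<in> V"
        using ab unfolding H_def by blast+
      then show ?thesis by (simp add: algebra_simps)
    qed
    then show "a - b \<in> H" by (simp add: H_def)
  qed
  moreover have "H \<subseteq> A"
  proof
    fix w assume "w \<in> H"
    then have "0 \<in> V \<longleftrightarrow> w + 0 \<in> V" unfolding H_def by blast
    then show "w \<in> A" using V(3,4) by auto
  qed
  ultimately show thesis using that by blast
qed

lemma open_subgroup_finite_index: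
  fixes H :: "'x::{topological_space, ab_group_add, topological_group_add} set"
  assumes comp: "compact (UNIV :: 'x set)" and H: "open H" "zm.subspace H"
  obtains F where "finite F" "\<And>y. \<exists>x\<in>F. y - x \<in> H"
proof -
  have "open ((\<lambda>y. y - x) -` H)" for x
    by (rule open_vimage[OF H(1)]) (auto intro!: continuous_intros)
  moreover have "UNIV \<subseteq> (\<Union>x\<in>UNIV. (\<lambda>y. y - x) -` H)"
    using zm.subspace_0[OF H(2)] by auto
  ultimately obtain F where "finite F" "UNIV \<subseteq> (\<Union>x\<in>F. (\<lambda>y. y - x) -` H)"
    using compactE_image[OF comp, of UNIV "\<lambda>x. (\<lambda>y. y - x) -` H"] by metis
  then show thesis using that by fastforce
qed

section \<open>Characters as an additive group\<close>

typedef (overloaded) 'x pdual = "dual_group :: ('x::{topological_space, ab_group_add} \<Rightarrow> complex) set"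
  morphisms chr Pdual
  by (rule exI[of _ "\<lambda>_. 1"]) (auto simp: dual_group_def)

lemma continuous_chr: "continuous_on A (chr a)"
  and chr_plus: "chr a (x + y) = chr a x * chr a y"
  and cmod_chr: "cmod (chr a x) = 1"
  using chr[of a] by (auto simp: dual_group_def intro: continuous_on_subset)

lemma chr_nonzero: "chr a x \<noteq> 0"
  using cmod_chr[of a x] by auto

lemma chr_at_0: "chr a 0 = 1"
  using chr_plus[of a 0 0] chr_nonzero[of a 0] by simp

lemma chr_uminus_arg: "chr a (- x) = inverse (chr a x)"
  using chr_plus[of a x "- x"] chr_nonzero[of a x] by (simp add: chr_at_0 field_simps)

lemma chr_diff_arg: "chr a (x - y) = chr a x / chr a y"
  using chr_plus[of a x "- y"] by (simp add: chr_uminus_arg field_simps)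

instantiation pdual :: ("{topological_space, ab_group_add}") ab_group_add
begin

definition "0 = Pdual (\<lambda>_. 1)"
definition "a + b = Pdual (\<lambda>x. chr a x * chr b x)"
definition "- a = Pdual (\<lambda>x. inverse (chr a x))"
definition "a - b = Pdual (\<lambda>x. chr a x * inverse (chr b x))"

lemma chr_0: "chr 0 = (\<lambda>_. 1)"
  unfolding zero_pdual_def by (rule Pdual_inverse) (auto simp: dual_group_def)

lemma chr_add: "chr (a + b) = (\<lambda>x. chr a x * chr b x)"
  unfolding plus_pdual_def
  by (rule Pdual_inverse)
     (auto simp: dual_group_def chr_plus cmod_chr norm_mult intro!: continuous_intros continuous_chr)

lemma chr_uminus: "chr (- a) = (\<lambda>x. inverse (chr a x))"
  unfolding uminus_pdual_def
  by (rule Pdual_inverse)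
     (auto simp: dual_group_def chr_plus cmod_chr norm_inverse chr_nonzero intro!: continuous_intros continuous_chr)

lemma chr_diff: "chr (a - b) = (\<lambda>x. chr a x * inverse (chr b x))"
  unfolding minus_pdual_def
  by (rule Pdual_inverse)
     (auto simp: dual_group_def chr_plus cmod_chr norm_mult norm_inverse chr_nonzero intro!: continuous_intros continuous_chr)

instance
  by standard (auto simp: chr_inject[symmetric] chr_0 chr_add chr_uminus chr_diff chr_nonzero)

end

lemma pdual_eqI: "(\<And>x. chr a x = chr b x) \<Longrightarrow> a = b"
  by (simp add: chr_inject[symmetric] fun_eq_iff)

lemma chr_sum: "chr (\<Sum>i\<in>I. f i) x = (\<Prod>i\<in>I. chr (f i) x)"
  by (induction I rule: infinite_finite_induct) (auto simp: chr_0 chr_add)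

lemma chr_zmul: "chr (zmul k a) x = chr a x powi k"
  by (simp add: zmul_def chr_diff chr_sum power_int_def power_inverse)

lemma chr_zmul_arg: "chr a (zmul k x) = chr a x powi k"
proof -
  have *: "chr a (\<Sum>i<n. x) = chr a x ^ n" for n :: nat
    by (induction n) (auto simp: chr_at_0 chr_plus)
  show ?thesis by (simp add: zmul_def chr_diff_arg * power_int_def field_simps)
qed

text \<open>Doubling \<open>x\<close> multiplies the distance of the value \<open>z\<close> from 1 by \<open>|z + 1| \<ge> 3/2\<close>.\<close>

lemma no_small_subgroup:
  assumes H: "zm.subspace H" and small: "\<And>x. x \<in> H \<Longrightarrow> cmod (chr a x - 1) \<le> 1 / 2" and "x \<in> H"
  shows "chr a x = 1"
proof -
  have "\<forall>x\<in>H. cmod (chr a x - 1) \<le> (2/3) ^ k" for k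
  proof (induction k)
    case 0
    then show ?case using small by fastforce
  next
    case (Suc k)
    show ?case
    proof
      fix x assume x: "x \<in> H"
      let ?z = "chr a x"
      have "cmod ((?z - 1) * (?z + 1)) \<le> (2/3) ^ k"
        using Suc.IH zm.subspace_add[OF H x x] by (auto simp: chr_plus algebra_simps)
      moreover have "2 \<le> cmod (?z + 1) + cmod (?z - 1)"
        using norm_triangle_ineq4[of "?z + 1" "?z - 1"] by simp
      then have "3/2 \<le> cmod (?z + 1)" using small[OF x] by simp
      then have "cmod (?z - 1) * (3/2) \<le> cmod (?z - 1) * cmod (?z + 1)" by (intro mult_left_mono) auto
      ultimately show "cmod (?z - 1) \<le> (2/3) ^ Suc k" by (simp add: norm_mult)
    qed
  qed
  then have "cmod (chr a x - 1) \<le> (2/3) ^ k" for k using assms(3) by blast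
  moreover have "(\<lambda>k. (2/3::real) ^ k) \<longlonglongrightarrow> 0" by (rule LIMSEQ_realpow_zero) auto
  ultimately have "cmod (chr a x - 1) \<le> 0" by (intro LIMSEQ_le_const) auto
  then show ?thesis by simp
qed

text \<open>Near 0 the values are close to 1, and zero-dimensionality puts an open subgroup there;
  its image is a subgroup of the circle too small to be nontrivial.\<close>

lemma open_kernel:
  fixes a :: "'x::{topological_space, ab_group_add, topological_group_add} pdual"
  assumes "compact (UNIV :: 'x set)" "zero_dimensional TYPE('x)"
  obtains H where "open H" "zm.subspace H" "\<And>x. x \<in> H \<Longrightarrow> chr a x = 1"
proof -
  let ?A = "{x. cmod (chr a x - 1) < 1 / 2}"
  have "open ?A"
    by (intro open_Collect_less continuous_intros continuous_chr)
  moreover have "0 \<in> ?A" by (simp add: chr_at_0)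
  ultimately obtain H where H: "open H" "zm.subspace H" "H \<subseteq> ?A"
    using open_subgroup_exists[OF assms] by blast
  have "chr a x = 1" if "x \<in> H" for x
    by (rule no_small_subgroup[OF H(2) _ that]) (use H(3) in force)
  then show thesis using that H by blast
qed

text \<open>A character is constant on the cosets of its open kernel subgroup, and by compactness
  there are finitely many cosets.\<close>

lemma finite_range_chr:
  fixes a :: "'x::{topological_space, ab_group_add, topological_group_add} pdual"
  assumes "compact (UNIV :: 'x set)" "zero_dimensional TYPE('x)"
  shows "finite (range (chr a))"
proof -
  obtain H where H: "open H" "zm.subspace H" "\<And>x. x \<in> H \<Longrightarrow> chr a x = 1"
    using open_kernel[OF assms] by blast
  obtain F where F: "finite F" "\<And>y. \<exists>x\<in>F. y - x \<in> H"
    using open_subgroup_finite_index[OF assms(1) H(1,2)] by blast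
  have "range (chr a) \<subseteq> chr a ` F"
  proof
    fix z assume "z \<in> range (chr a)"
    then obtain y where y: "z = chr a y" by blast
    obtain x where x: "x \<in> F" "y - x \<in> H" using F(2) by blast
    have "chr a (y - x) = 1" by (rule H(3)[OF x(2)])
    then have "z = chr a x" using y by (simp add: chr_diff_arg chr_nonzero)
    then show "z \<in> chr a ` F" using x(1) by blast
  qed
  then show ?thesis using F(1) finite_subset by blast
qed

text \<open>By pigeonhole each value is a root of unity of order at most the number of values, so
  the factorial of that number is a common exponent.\<close>

lemma pdual_torsion:
  fixes a :: "'x::{topological_space, ab_group_add, topological_group_add} pdual"
  assumes "compact (UNIV :: 'x set)" "zero_dimensional TYPE('x)"
  shows "\<exists>n>0. zmul (int n) a = 0"
proof -
  let ?Z = "range (chr a)"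
  have fin: "finite ?Z" by (rule finite_range_chr[OF assms])
  have "chr a x ^ fact (card ?Z) = 1" for x
  proof -
    have "(\<lambda>i. chr a x ^ i) ` {..card ?Z} \<subseteq> ?Z"
      using chr_zmul_arg[of a "int _" x] by (auto intro: range_eqI[OF sym])
    then have "card ((\<lambda>i. chr a x ^ i) ` {..card ?Z}) \<le> card ?Z"
      by (rule card_mono[OF fin])
    then have "card ((\<lambda>i. chr a x ^ i) ` {..card ?Z}) < card {..card ?Z}" by simp
    from pigeonhole[OF this] obtain i j where ij: "i \<le> card ?Z" "j \<le> card ?Z" "i < j" "chr a x ^ i = chr a x ^ j"
      unfolding inj_on_def by (metis atMost_iff linorder_neqE_nat)
    obtain k where k: "j = i + k" "k > 0" using ij(3) less_imp_add_positive by blast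
    have "chr a x ^ k = 1" using ij(4) by (simp add: k power_add chr_nonzero)
    moreover have "k dvd fact (card ?Z)" using k ij(2) by (intro dvd_fact) auto
    ultimately show ?thesis by (auto simp: power_mult elim!: dvdE)
  qed
  then have "zmul (int (fact (card ?Z))) a = 0"
    by (intro pdual_eqI) (simp add: chr_zmul chr_0 del: of_nat_fact)
  then show ?thesis using fact_gt_zero by blast
qed

text \<open>Finitely many values leave a gap around 1, and uniform continuity keeps quotients of
  values inside it. In the entropy estimate, different character values thus force a definite
  distance between points.\<close>

lemma chr_uniformly_locally_constant:
  fixes a :: "'x::{metric_space, ab_group_add, topological_group_add} pdual"
  assumes "compact (UNIV :: 'x set)" "zero_dimensional TYPE('x)"
  shows "\<exists>\<delta>>0. \<forall>x y. dist x y < \<delta> \<longrightarrow> chr a x = chr a y"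
proof -
  obtain e where e: "e > 0" "\<And>z. z \<in> range (chr a) \<Longrightarrow> z \<noteq> 1 \<Longrightarrow> e \<le> dist 1 z"
    using finite_set_avoid[OF finite_range_chr[OF assms]] by metis
  have "uniformly_continuous_on UNIV (chr a)"
    by (rule compact_uniformly_continuous[OF continuous_chr assms(1)])
  then obtain \<delta> where \<delta>: "\<delta> > 0" "\<And>x y. dist y x < \<delta> \<Longrightarrow> dist (chr a y) (chr a x) < e"
    using e(1) unfolding uniformly_continuous_on_def by (metis UNIV_I)
  have "chr a x = chr a y" if "dist x y < \<delta>" for x y
  proof -
    have "1 - chr a (x - y) = (chr a y - chr a x) / chr a y"
      by (simp add: chr_diff_arg chr_nonzero diff_divide_distrib)
    then have "dist 1 (chr a (x - y)) = dist (chr a y) (chr a x)"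
      by (simp add: dist_norm norm_divide cmod_chr)
    also have "\<dots> < e" using \<delta>(2) that by (metis dist_commute)
    finally have "chr a (x - y) = 1" using e(2) by (meson not_le rangeI)
    then show ?thesis by (simp add: chr_diff_arg chr_nonzero)
  qed
  then show ?thesis using \<delta>(1) by blast
qed

section \<open>Extension and separation by characters\<close>

lemma extend_hom:
  fixes f :: "'x::ab_group_add \<Rightarrow> complex"
  assumes K: "zm.subspace K" and hom: "\<And>a b. a \<in> K \<Longrightarrow> b \<in> K \<Longrightarrow> f (a + b) = f a * f b"
    and norm: "\<And>a. a \<in> K \<Longrightarrow> cmod (f a) = 1"
    and w: "cmod w = 1" "\<And>j. zmul j y \<in> K \<Longrightarrow> f (zmul j y) = w powi j"
  obtains K' f' where "zm.subspace K'" "K \<subseteq> K'" "y \<in> K'"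
    "\<And>a b. a \<in> K' \<Longrightarrow> b \<in> K' \<Longrightarrow> f' (a + b) = f' a * f' b"
    "\<And>a. a \<in> K' \<Longrightarrow> cmod (f' a) = 1" "\<And>a. a \<in> K \<Longrightarrow> f' a = f a" "f' y = w"
proof -
  have w0: "w \<noteq> 0" using w(1) by auto
  define K' where "K' = {k + zmul j y | k j. k \<in> K}"
  \<comment> \<open>The hypothesis on \<open>w\<close> is exactly what makes this value independent
    of the representation \<open>k + zmul j y\<close>.\<close>
  define f' where "f' z = (THE c. \<exists>k j. k \<in> K \<and> z = k + zmul j y \<and> c = f k * w powi j)" for z
  have f': "f' (k + zmul j y) = f k * w powi j" if k: "k \<in> K" for k j
    unfolding f'_def
  proof (rule the_equality)
    show "\<exists>k' j'. k' \<in> K \<and> k + zmul j y = k' + zmul j' y \<and> f k * w powi j = f k' * w powi j'"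
      using k by blast
    fix c assume "\<exists>k' j'. k' \<in> K \<and> k + zmul j y = k' + zmul j' y \<and> c = f k' * w powi j'"
    then obtain k' j' where k': "k' \<in> K" "k + zmul j y = k' + zmul j' y" "c = f k' * w powi j'" by blast
    have e: "zmul (j - j') y = k' - k"
      using k'(2) by (simp add: zm.scale_left_diff_distrib algebra_simps)
    have d: "k' - k \<in> K" using zm.subspace_diff[OF K k'(1) k] .
    have "f k' = f (k + (k' - k))" by simp
    also have "\<dots> = f k * f (k' - k)" by (rule hom[OF k d])
    also have "f (k' - k) = w powi (j - j')" using w(2)[of "j - j'"] d e by simp
    finally show "c = f k * w powi j" using w0 k'(3) by (simp add: power_int_diff)
  qed
  have "zm.subspace K'"
  proof (rule zm_subspace_diffI)
    show "0 \<in> K'" unfolding K'_def using zm.subspace_0[OF K]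
      by (auto intro!: exI[of _ 0])
    fix a b assume "a \<in> K'" "b \<in> K'"
    then obtain k j k' j' where "k \<in> K" "k' \<in> K" "a = k + zmul j y" "b = k' + zmul j' y"
      unfolding K'_def by blast
    then have "k - k' \<in> K" "a - b = (k - k') + zmul (j - j') y"
      using zm.subspace_diff[OF K] by (auto simp: zm.scale_left_diff_distrib)
    then show "a - b \<in> K'" unfolding K'_def by blast
  qed
  moreover have f'K: "k \<in> K \<Longrightarrow> k \<in> K' \<and> f' k = f k" for k
    using f'[of k 0] unfolding K'_def by (simp, intro exI[of _ k] conjI exI[of _ 0]) simp_all
  moreover have f0: "f 0 = 1"
    using w(2)[of 0] zm.subspace_0[OF K] by simp
  then have "y \<in> K'" "f' y = w"
    using f'[of 0 1] zm.subspace_0[OF K] unfolding K'_def by (auto simp: zmul_one intro!: exI[of _ 0] exI[of _ 1])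
  moreover have "f' (a + b) = f' a * f' b" if ab: "a \<in> K'" "b \<in> K'" for a b
  proof -
    obtain k j k' j' where *: "k \<in> K" "k' \<in> K" "a = k + zmul j y" "b = k' + zmul j' y"
      using ab unfolding K'_def by blast
    have "a + b = (k + k') + zmul (j + j') y" by (simp add: * zmul_add_left)
    then have "f' (a + b) = f (k + k') * w powi (j + j')"
      using f'[OF zm.subspace_add[OF K *(1,2)]] by simp
    then show ?thesis using f'[OF *(1)] f'[OF *(2)] * w0 by (simp add: hom power_int_add)
  qed
  moreover have "cmod (f' a) = 1" if a: "a \<in> K'" for a
  proof -
    obtain k j where *: "k \<in> K" "a = k + zmul j y" using a unfolding K'_def by blast
    then show ?thesis by (simp add: f' norm_mult norm w(1) norm_power_int)
  qed
  ultimately show thesis using that[of K' f'] by blast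
qed

text \<open>If the obvious root \<open>cis (t / m)\<close> is 1, then \<open>c\<close> is 1 and a
  primitive root of unity takes its place.\<close>

lemma nontrivial_root:
  assumes "cmod c = 1" "m \<ge> 2"
  obtains w where "w ^ m = c" "cmod w = 1" "w \<noteq> 1"
proof -
  have "c = cis (Arg c)" using rcis_cmod_Arg[of c] assms(1) by (simp add: rcis_def)
  then obtain t where t: "c = cis t" by blast
  show thesis
  proof (cases "cis (t / m) = 1")
    case False
    have "cis (t / m) ^ m = c" using assms(2) by (simp only: Complex.DeMoivre) (simp add: t)
    then show thesis using that[of "cis (t / m)"] False by simp
  next
    case True
    have "c = cis (t / m) ^ m" using assms(2) by (simp only: Complex.DeMoivre) (simp add: t)
    then have c: "c = 1" using True by simp
    have "cis (2 * pi / m) \<noteq> 1"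
    proof
      assume "cis (2 * pi / m) = 1"
      then have "cos (2 * pi / m) = 1" by (simp add: complex_eq_iff)
      moreover have "cos (2 * pi / m) < cos 0"
        using assms(2) by (intro cos_monotone_0_pi) (auto simp: field_simps)
      ultimately show False by simp
    qed
    moreover have "cis (2 * pi / m) ^ m = c" using assms(2) by (simp only: Complex.DeMoivre) (simp add: c)
    ultimately show thesis using that[of "cis (2 * pi / m)"] by simp
  qed
qed

text \<open>With \<open>m\<close> the order of \<open>y\<close> modulo \<open>K\<close>, the only
  constraint on \<open>w\<close> is w^m = f(my). Since \<open>y\<close> is outside \<open>K\<close>,
  \<open>m\<close> is at least 2, which leaves room for a value other than 1.\<close>

lemma extension_value:
  fixes f :: "'x::ab_group_add \<Rightarrow> complex"
  assumes K: "zm.subspace K" and hom: "\<And>a b. a \<in> K \<Longrightarrow> b \<in> K \<Longrightarrow> f (a + b) = f a * f b"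
    and norm: "\<And>a. a \<in> K \<Longrightarrow> cmod (f a) = 1"
    and y: "y \<notin> K" and n: "n > 0" "zmul (int n) y \<in> K"
  obtains w where "cmod w = 1" "w \<noteq> 1" "\<And>j. zmul j y \<in> K \<Longrightarrow> f (zmul j y) = w powi j"
proof -
  define m where "m = (LEAST n. n > 0 \<and> zmul (int n) y \<in> K)"
  have m: "m > 0" "zmul (int m) y \<in> K"
    using LeastI[of "\<lambda>n. n > 0 \<and> zmul (int n) y \<in> K", OF conjI[OF n]] by (auto simp: m_def)
  have least: "k \<ge> m" if "k > 0" "zmul (int k) y \<in> K" for k
    unfolding m_def using that by (intro Least_le) auto
  have "m \<noteq> 1" using m(2) y by (auto simp: zmul_one)
  then have "m \<ge> 2" using m(1) by simp
  from nontrivial_root[OF norm[OF m(2)] this] obtain w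
    where w: "w ^ m = f (zmul (int m) y)" "cmod w = 1" "w \<noteq> 1" by blast
  have w0: "w \<noteq> 0" using w(2) by auto
  have f0: "f 0 = 1"
    using hom[of 0 0] norm[of 0] zm.subspace_0[OF K] by auto
  have nat: "f (zmul (int t) z) = f z ^ t" if "z \<in> K" for t z
  proof (induction t)
    case (Suc t)
    then show ?case
      using hom[OF that zm.subspace_scale[OF K that, of "int t"]] by (simp only: zmul_of_nat_Suc) simp
  qed (simp add: f0)
  have int: "f (zmul t z) = f z powi t" if "z \<in> K" for t z
  proof (cases t)
    case (nonneg n)
    then show ?thesis using nat[OF that] by simp
  next
    case (neg n)
    have "f (zmul t z + zmul (- t) z) = f (zmul t z) * f (zmul (- t) z)"
      by (intro hom zm.subspace_scale K that)
    then have "f (zmul t z) * f z ^ Suc n = 1"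
      using nat[OF that, of "Suc n"] f0 by (simp add: zmul_add_left[symmetric] neg del: power_Suc of_nat_Suc)
    moreover have "f z \<noteq> 0" using norm[OF that] by auto
    ultimately show ?thesis by (simp add: neg power_int_minus field_simps del: power_Suc of_nat_Suc)
  qed
  have "f (zmul j y) = w powi j" if j: "zmul j y \<in> K" for j
  proof -
    have "zmul (j mod int m) y = zmul j y - zmul (j div int m) (zmul (int m) y)"
      by (simp add: zmul_mult[symmetric] zm.scale_left_diff_distrib[symmetric] minus_div_mult_eq_mod del: zm.scale_scale)
    also have "\<dots> \<in> K" by (intro zm.subspace_diff zm.subspace_scale K j m)
    finally have r: "zmul (j mod int m) y \<in> K" .
    have "j mod int m = 0"
    proof (rule ccontr)
      assume "j mod int m \<noteq> 0"
      moreover have "0 \<le> j mod int m" "j mod int m < int m" using m(1) by auto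
      ultimately show False using least[of "nat (j mod int m)"] r by simp
    qed
    then obtain t where t: "j = t * int m" by (metis dvd_def mod_0_imp_dvd mult.commute)
    have "f (zmul j y) = f (zmul (int m) y) powi t"
      unfolding t zmul_mult by (rule int[OF m(2)])
    also have "\<dots> = w powi j"
      unfolding t mult.commute[of t] by (simp add: w(1)[symmetric] power_int_mult)
    finally show ?thesis .
  qed
  then show thesis using that w by blast
qed

text \<open>An open subgroup \<open>H\<close> avoiding \<open>x\<close> has finite index. The
  trivial character of \<open>H\<close> is extended to \<open>x\<close> with a value other than 1,
  then to the whole group; triviality on \<open>H\<close> makes the result locally constant, hence
  continuous.\<close>

lemma characters_separate:
  fixes x :: "'x::{metric_space, ab_group_add, topological_group_add}"
  assumes comp: "compact (UNIV :: 'x set)" and zd: "zero_dimensional TYPE('x)" and x: "x \<noteq> 0"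
  shows "\<exists>a. chr a x \<noteq> 1"
proof -
  have "open (- {x})" "0 \<in> - {x}" using x by auto
  from open_subgroup_exists[OF comp zd this]
  obtain H where H: "open H" "zm.subspace H" "H \<subseteq> - {x}" by blast
  obtain F where F: "finite F" "\<And>y. \<exists>x\<in>F. y - x \<in> H"
    using open_subgroup_finite_index[OF comp H(1,2)] by blast
  have mult: "\<exists>n>0. zmul (int n) y \<in> H" for y
  proof -
    have "\<forall>i. \<exists>r\<in>F. zmul (int i) y - r \<in> H" using F(2) by blast
    then obtain r where r: "\<And>i. r i \<in> F" "\<And>i. zmul (int i) y - r i \<in> H" by metis
    have "\<not> inj (r :: nat \<Rightarrow> 'x)"
      using F(1) r(1) by (meson finite_imageD finite_subset image_subsetI infinite_UNIV_nat)
    then obtain i j :: nat where ij: "i < j" "r i = r j" unfolding inj_def by (metis linorder_neqE_nat)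
    have "(zmul (int j) y - r j) - (zmul (int i) y - r i) \<in> H"
      by (intro zm.subspace_diff H r)
    then have "zmul (int (j - i)) y \<in> H" using ij by (simp add: of_nat_diff zm.scale_left_diff_distrib)
    then show ?thesis using ij(1) by (intro exI[of _ "j - i"]) auto
  qed
  define good where "good K f \<longleftrightarrow> zm.subspace K \<and> H \<subseteq> K \<and> x \<in> K \<and> f x \<noteq> 1 \<and>
     (\<forall>a\<in>K. \<forall>b\<in>K. f (a + b) = f a * f b) \<and> (\<forall>a\<in>K. cmod (f a) = 1) \<and> (\<forall>a\<in>H. f a = 1)"
    for K and f :: "'x \<Rightarrow> complex"
  have ex: "\<exists>K f. good K f"
  proof -
    have xH: "x \<notin> H" using H(3) by auto
    obtain n where n: "n > 0" "zmul (int n) x \<in> H" using mult by blast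
    obtain w where w: "cmod w = 1" "w \<noteq> 1" "\<And>j. zmul j x \<in> H \<Longrightarrow> 1 = w powi j"
      using extension_value[where f = "\<lambda>_. 1", OF H(2) _ _ xH n] by auto
    obtain K f where "zm.subspace K" "H \<subseteq> K" "x \<in> K"
      "\<And>a b. a \<in> K \<Longrightarrow> b \<in> K \<Longrightarrow> f (a + b) = f a * f b"
      "\<And>a. a \<in> K \<Longrightarrow> cmod (f a) = 1" "\<And>a. a \<in> H \<Longrightarrow> f a = 1" "f x = w"
      by (rule extend_hom[where f = "\<lambda>_. 1", OF H(2) _ _ w(1,3)]) auto
    then show ?thesis using w(2) unfolding good_def by metis
  qed
  \<comment> \<open>Maximality is measured by the number of coset representatives in the domain. It
    is bounded by \<open>card F\<close>, and each further extension increases it.\<close>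
  have "\<exists>K f. good K f \<and> (\<forall>K' f'. good K' f' \<longrightarrow> card (F \<inter> K') \<le> card (F \<inter> K))"
  proof -
    obtain K0 f0 where "good K0 f0" using ex by blast
    then have "\<exists>p. (case p of (K, f) \<Rightarrow> good K f) \<and>
       (\<forall>q. (case q of (K, f) \<Rightarrow> good K f) \<longrightarrow> card (F \<inter> fst q) \<le> card (F \<inter> fst p))"
      by (intro ex_has_greatest_nat[of _ "(K0, f0)" _ "Suc (card F)"])
         (auto simp: less_Suc_eq_le intro!: card_mono F)
    then show ?thesis by auto
  qed
  then obtain K f where K: "good K f" "\<And>K' f'. good K' f' \<Longrightarrow> card (F \<inter> K') \<le> card (F \<inter> K)" by blast
  have Ksub: "zm.subspace K" and HK: "H \<subseteq> K" and hom: "\<And>a b. a \<in> K \<Longrightarrow> b \<in> K \<Longrightarrow> f (a + b) = f a * f b"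
    and norm: "\<And>a. a \<in> K \<Longrightarrow> cmod (f a) = 1" and fH: "\<And>a. a \<in> H \<Longrightarrow> f a = 1" and fx: "f x \<noteq> 1" "x \<in> K"
    using K(1) unfolding good_def by blast+
  have UNIV: "K = UNIV"
  proof (rule ccontr)
    assume "K \<noteq> UNIV"
    then obtain y0 where "y0 \<notin> K" by blast
    obtain y where y: "y \<in> F" "y0 - y \<in> H" using F(2) by blast
    have yK: "y \<notin> K"
      using zm.subspace_add[OF Ksub, of y "y0 - y"] y(2) HK \<open>y0 \<notin> K\<close> by auto
    obtain n where n: "n > 0" "zmul (int n) y \<in> K" using mult HK by blast
    obtain w where w: "cmod w = 1" "w \<noteq> 1" "\<And>j. zmul j y \<in> K \<Longrightarrow> f (zmul j y) = w powi j"
      using extension_value[OF Ksub hom norm yK n] by blast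
    obtain K' f' where K': "zm.subspace K'" "K \<subseteq> K'" "y \<in> K'"
      "\<And>a b. a \<in> K' \<Longrightarrow> b \<in> K' \<Longrightarrow> f' (a + b) = f' a * f' b"
      "\<And>a. a \<in> K' \<Longrightarrow> cmod (f' a) = 1" "\<And>a. a \<in> K \<Longrightarrow> f' a = f a"
      by (rule extend_hom[OF Ksub hom norm w(1,3)]) blast+
    have "good K' f'" unfolding good_def using K' HK fx fH by (auto simp: subset_iff)
    then have "card (F \<inter> K') \<le> card (F \<inter> K)" by (rule K(2))
    moreover have "F \<inter> K \<subset> F \<inter> K'" using K'(2,3) y(1) yK by blast
    then have "card (F \<inter> K) < card (F \<inter> K')" using F(1) by (intro psubset_card_mono) auto
    ultimately show False by simp
  qed
  have const: "f z = f y" if "z - y \<in> H" for y z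
    using hom[of "z - y" y] fH[OF that] UNIV by simp
  have "continuous_on UNIV f"
    unfolding continuous_on_def
  proof
    fix y :: 'x
    have "open ((\<lambda>z. z - y) -` H)"
      by (rule open_vimage[OF H(1)]) (auto intro!: continuous_intros)
    then have "eventually (\<lambda>z. z \<in> (\<lambda>z. z - y) -` H) (nhds y)"
      using zm.subspace_0[OF H(2)] by (intro eventually_nhds_in_open) auto
    then have "eventually (\<lambda>z. f z = f y) (at y)"
      using const by (auto simp: eventually_at_filter elim!: eventually_mono)
    then show "(f \<longlongrightarrow> f y) (at y within UNIV)" by (rule tendsto_eventually)
  qed
  then have "f \<in> dual_group" using hom norm UNIV by (auto simp: dual_group_def)
  then have "chr (Pdual f) x = f x" by (simp add: Pdual_inverse)
  then show ?thesis using fx(1) by metis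
qed

text \<open>Both sides equal the double sum of \<open>\<phi> a\<close> over all patterns \<open>\<phi>\<close> and all \<open>a \<in> D\<close>, by
  orthogonality in either variable.\<close>

lemma card_patterns:
  fixes D :: "'x::{topological_space, ab_group_add, topological_group_add} pdual set"
  assumes comp: "compact (UNIV :: 'x set)" and zd: "zero_dimensional TYPE('x)"
    and D: "finite D" "zm.subspace D"
  shows "finite (range (\<lambda>x. restrict (\<lambda>a. chr a x) D)) \<and> card (range (\<lambda>x. restrict (\<lambda>a. chr a x) D)) = card D"
proof -
  define \<Phi> where "\<Phi> x = restrict (\<lambda>a. chr a x) D" for x
  have "range \<Phi> \<subseteq> Pi\<^sub>E D (\<lambda>a. range (chr a))" by (auto simp: \<Phi>_def)
  then have fin: "finite (range \<Phi>)"
    using finite_PiE[OF D(1)] finite_range_chr[OF comp zd] finite_subset by metis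
  have inner: "(\<Sum>a\<in>D. chr a x) = (if \<Phi> x = \<Phi> 0 then of_nat (card D) else 0)" for x
  proof (cases "\<forall>a\<in>D. chr a x = 1")
    case True
    then have "\<Phi> x = \<Phi> 0" by (auto simp: \<Phi>_def chr_at_0)
    then show ?thesis using True by simp
  next
    case False
    then obtain b where b: "b \<in> D" "chr b x \<noteq> 1" by blast
    have "(\<Sum>a\<in>D. chr a x) = (\<Sum>a\<in>D. chr (a + b) x)"
      by (rule sum.reindex_bij_witness[of _ "\<lambda>a. a + b" "\<lambda>a. a - b"])
         (auto intro: zm.subspace_add[OF D(2)] zm.subspace_diff[OF D(2)] b(1))
    also have "\<dots> = chr b x * (\<Sum>a\<in>D. chr a x)" by (simp add: chr_add sum_distrib_left mult.commute)
    finally have "(\<Sum>a\<in>D. chr a x) = 0" using b(2) by (metis mult_cancel_right1)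
    moreover have "\<Phi> x \<noteq> \<Phi> 0"
      using b by (auto simp: \<Phi>_def chr_at_0 dest!: fun_cong[of _ _ b])
    ultimately show ?thesis by simp
  qed
  have outer: "(\<Sum>\<phi>\<in>range \<Phi>. \<phi> a) = (if a = 0 then of_nat (card (range \<Phi>)) else 0)" if a: "a \<in> D" for a
  proof (cases "a = 0")
    case True
    have "\<phi> a = 1" if "\<phi> \<in> range \<Phi>" for \<phi> using that a by (auto simp: \<Phi>_def True chr_0)
    then have "(\<Sum>\<phi>\<in>range \<Phi>. \<phi> a) = (\<Sum>\<phi>\<in>range \<Phi>. 1)" by (rule sum.cong[OF refl])
    then show ?thesis using True by simp
  next
    case False
    then obtain y where y: "chr a y \<noteq> 1" using pdual_eqI[of a 0] by (auto simp: chr_0)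
    \<comment> \<open>Translation by \<open>y\<close> permutes the patterns, with inverse the
      translation by \<open>- y\<close>; this gives the orthogonality relation.\<close>
    have shift: "(\<lambda>b\<in>D. \<Phi> x b * chr b y) = \<Phi> (x + y)" for x y
      by (auto simp: \<Phi>_def chr_plus)
    have "(\<Sum>\<phi>\<in>range \<Phi>. \<phi> a) = (\<Sum>\<phi>\<in>range \<Phi>. (\<lambda>b\<in>D. \<phi> b * chr b y) a)"
      by (rule sum.reindex_bij_witness[of _ "\<lambda>\<phi>. \<lambda>b\<in>D. \<phi> b * chr b y" "\<lambda>\<phi>. \<lambda>b\<in>D. \<phi> b * chr b (- y)"])
         (auto simp del: restrict_apply restrict_apply' simp: shift)
    also have "\<dots> = chr a y * (\<Sum>\<phi>\<in>range \<Phi>. \<phi> a)" using a by (simp add: sum_distrib_left mult.commute)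
    finally have "(\<Sum>\<phi>\<in>range \<Phi>. \<phi> a) = 0" using y by (metis mult_cancel_right1)
    then show ?thesis using False by simp
  qed
  have "of_nat (card (range \<Phi>)) = (\<Sum>a\<in>D. if a = 0 then of_nat (card (range \<Phi>)) else (0::complex))"
    using D zm.subspace_0[OF D(2)] by (simp add: sum.delta)
  also have "\<dots> = (\<Sum>a\<in>D. \<Sum>\<phi>\<in>range \<Phi>. \<phi> a)" by (intro sum.cong) (auto simp: outer)
  also have "\<dots> = (\<Sum>\<phi>\<in>range \<Phi>. \<Sum>a\<in>D. \<phi> a)" by (rule sum.swap)
  also have "\<dots> = (\<Sum>\<phi>\<in>range \<Phi>. if \<phi> = \<Phi> 0 then of_nat (card D) else 0)"
  proof (rule sum.cong[OF refl])
    fix \<phi> assume "\<phi> \<in> range \<Phi>"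
    then obtain x where x: "\<phi> = \<Phi> x" by blast
    have "(\<Sum>a\<in>D. \<phi> a) = (\<Sum>a\<in>D. chr a x)" by (simp add: x \<Phi>_def)
    then show "(\<Sum>a\<in>D. \<phi> a) = (if \<phi> = \<Phi> 0 then of_nat (card D) else 0)" using inner x by simp
  qed
  also have "\<dots> = of_nat (card D)" using fin by (simp add: sum.delta)
  finally have "card (range \<Phi>) = card D" by (simp only: of_nat_eq_iff)
  then show ?thesis using fin by (simp add: \<Phi>_def)
qed

section \<open>Entropy and polynomial relations\<close>

lemma finite_positive_lower_bound:
  assumes "finite S" "\<And>s. s \<in> S \<Longrightarrow> (f s :: real) > 0"
  shows "\<exists>\<delta>>0. \<forall>s\<in>S. \<delta> \<le> f s"
  using assms by (intro exI[of _ "Min (insert 1 (f ` S))"]) auto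

text \<open>As a supremum of natural numbers, \<open>sepnum\<close> dominates the separated sets
  only once their sizes are bounded. Two points in one ball of radius \<delta>/2 stay
  \<epsilon>-close for the first \<open>n\<close> iterates, so a finite cover by such balls bounds
  the size.\<close>

lemma separated_card_bounded:
  fixes T :: "'x::metric_space \<Rightarrow> 'x"
  assumes comp: "compact (UNIV :: 'x set)" and cont: "continuous_on UNIV T" and "\<epsilon> > 0"
  shows "bdd_above {card E | E. finite E \<and> separated T n \<epsilon> E}"
proof -
  have "continuous_on UNIV (T ^^ k)" for k
    by (induction k) (auto simp: id_def intro!: continuous_on_compose2[OF cont])
  then have "uniformly_continuous_on UNIV (T ^^ k)" for k
    by (rule compact_uniformly_continuous[OF _ comp])
  then have "\<forall>k. \<exists>\<delta>>0. \<forall>x y. dist x y < \<delta> \<longrightarrow> dist ((T ^^ k) x) ((T ^^ k) y) < \<epsilon>"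
    using assms(3) unfolding uniformly_continuous_on_def by (metis UNIV_I)
  then obtain f where f: "\<And>k. f k > 0" "\<And>k x y. dist x y < f k \<Longrightarrow> dist ((T ^^ k) x) ((T ^^ k) y) < \<epsilon>"
    by metis
  obtain \<delta> where \<delta>: "\<delta> > 0" "\<And>k. k < n \<Longrightarrow> \<delta> \<le> f k"
    using finite_positive_lower_bound[of "{..<n}" f] f(1) by auto
  obtain F where F: "finite F" "(UNIV :: 'x set) \<subseteq> (\<Union>x\<in>F. ball x (\<delta> / 2))"
    using compactE_image[OF comp, of UNIV "\<lambda>x. ball x (\<delta> / 2)"] \<delta>(1) by (metis UNIV_I UN_I centre_in_ball half_gt_zero open_ball subsetI)
  have "\<forall>x. \<exists>c\<in>F. dist c x < \<delta> / 2" using F(2) by (auto simp: subset_iff)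
  then obtain c where c: "\<And>x. c x \<in> F" "\<And>x. dist (c x) x < \<delta> / 2" by metis
  have "card E \<le> card F" if E: "separated T n \<epsilon> E" for E
  proof (rule card_inj_on_le[of c])
    show "inj_on c E"
    proof (rule inj_onI, rule ccontr)
      fix x y assume xy: "x \<in> E" "y \<in> E" "c x = c y" "x \<noteq> y"
      have "dist x y < \<delta>"
        using dist_triangle_half_r[of "c x" x \<delta> y] c(2)[of x] c(2)[of y] xy(3) by simp
      moreover obtain k where "k < n" "dist ((T ^^ k) x) ((T ^^ k) y) > \<epsilon>"
        using E xy unfolding separated_def by blast
      ultimately show False using f(2)[of x y k] \<delta>(2)[of k] by auto
    qed
  qed (use c F in auto)
  then show ?thesis by (intro bdd_aboveI[of _ "card F"]) auto
qed

lemma sepnum_ge: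
  fixes T :: "'x::metric_space \<Rightarrow> 'x"
  assumes "compact (UNIV :: 'x set)" "continuous_on UNIV T" "\<epsilon> > 0" "finite E" "separated T n \<epsilon> E"
  shows "card E \<le> sepnum T n \<epsilon>"
  unfolding sepnum_def by (rule cSup_upper) (use separated_card_bounded[OF assms(1-3)] assms in auto)

lemma top_entropy_ge:
  assumes "\<epsilon> > 0" "P > 0" "\<And>n. P ^ n \<le> real (sepnum T n \<epsilon>)"
  shows "ereal (ln P) \<le> top_entropy T"
proof -
  have "ereal (ln P) \<le> ereal (ln (real (sepnum T n \<epsilon>)) / real n)" if "n \<ge> 1" for n
  proof -
    have "ln (P ^ n) \<le> ln (real (sepnum T n \<epsilon>))"
      using assms(2) by (intro ln_mono assms(3)) auto
    then show ?thesis using that assms(2) by (simp add: ln_realpow field_simps)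
  qed
  then have "ereal (ln P) \<le> limsup (\<lambda>n. ereal (ln (real (sepnum T n \<epsilon>)) / real n))"
    by (intro le_Limsup) (auto simp: eventually_at_top_linorder intro!: exI[of _ 1])
  also have "\<dots> \<le> top_entropy T"
    unfolding top_entropy_def using assms(1) by (intro SUP_upper) auto
  finally show ?thesis .
qed

definition dact :: "(('d::finite \<Rightarrow> int) \<Rightarrow> 'x \<Rightarrow> 'x) \<Rightarrow> ('d \<Rightarrow> int) \<Rightarrow>
    'x::{topological_space, ab_group_add} pdual \<Rightarrow> 'x pdual" where
  "dact \<alpha> n a = Pdual (\<lambda>x. chr a (\<alpha> n x))"

locale zd_system =
  fixes \<alpha> :: "('d::finite \<Rightarrow> int) \<Rightarrow> 'x::{metric_space, ab_group_add, topological_group_add} \<Rightarrow> 'x"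
  assumes comp: "compact (UNIV :: 'x set)"
    and zd: "zero_dimensional TYPE('x)"
    and action: "zd_action \<alpha>"
    and autos: "by_cont_automorphisms \<alpha>"
begin

lemma \<alpha>_0: "\<alpha> 0 x = x" and \<alpha>_plus: "\<alpha> (m + n) x = \<alpha> m (\<alpha> n x)"
  using action by (auto simp: zd_action_def)

lemma \<alpha>_add: "\<alpha> n (x + y) = \<alpha> n x + \<alpha> n y" and continuous_\<alpha>: "continuous_on UNIV (\<alpha> n)"
  using autos by (auto simp: by_cont_automorphisms_def)

lemma chr_dact: "chr (dact \<alpha> n a) = (\<lambda>x. chr a (\<alpha> n x))"
  unfolding dact_def
  by (rule Pdual_inverse)
     (auto simp: dual_group_def \<alpha>_add chr_plus cmod_chr intro!: continuous_on_compose2[OF continuous_chr continuous_\<alpha>])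

sublocale zd_module "dact \<alpha>"
proof
  show "dact \<alpha> 0 a = a" for a by (rule pdual_eqI) (simp add: chr_dact \<alpha>_0)
  show "dact \<alpha> (m + n) a = dact \<alpha> m (dact \<alpha> n a)" for m n a
    by (rule pdual_eqI) (simp only: chr_dact add.commute[of m] \<alpha>_plus)
  show "dact \<alpha> n (a + b) = dact \<alpha> n a + dact \<alpha> n b" for n a b
    by (rule pdual_eqI) (simp add: chr_dact chr_add)
qed

text \<open>One point is chosen for each pattern of values on the span of the first \<open>n\<close>
  translates of \<open>B\<close>; orthogonality says that there are as many patterns as characters
  in the span. The scale at which these points are separated depends on \<open>B\<close> alone and
  not on \<open>n\<close>.\<close>

lemma entropy_lower_bound:
  fixes e :: "'d \<Rightarrow> int"
  defines "G \<equiv> \<lambda>B n. (\<lambda>(k, b). dact \<alpha> (\<lambda>i. int k * e i) b) ` ({..<n} \<times> B)"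
  assumes B: "finite B" and "P > 0"
    and D: "\<And>n. finite (zspan (G B n))" "\<And>n. P ^ n \<le> real (card (zspan (G B n)))"
  shows "ereal (ln P) \<le> top_entropy (\<alpha> e)"
proof -
  have pow: "(\<alpha> e ^^ k) x = \<alpha> (\<lambda>i. int k * e i) x" for k x
  proof (induction k)
    case 0
    have "(\<lambda>i. int 0 * e i) = 0" by auto
    then show ?case by (simp add: \<alpha>_0 del: of_nat_0)
  next
    case (Suc k)
    have "(\<lambda>i. int (Suc k) * e i) = e + (\<lambda>i. int k * e i)" by (auto simp: algebra_simps)
    then show ?case by (simp only: \<alpha>_plus funpow.simps o_def Suc)
  qed
  have "\<forall>b :: 'x pdual. \<exists>\<delta>>0. \<forall>x y. dist x y < \<delta> \<longrightarrow> chr b x = chr b y"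
    by (intro allI chr_uniformly_locally_constant comp zd)
  then obtain f where f: "\<And>b :: 'x pdual. f b > 0" "\<And>b x y. dist x y < f b \<Longrightarrow> chr b x = chr b y" by metis
  obtain \<delta> where \<delta>: "\<delta> > 0" "\<And>b. b \<in> B \<Longrightarrow> \<delta> \<le> f b"
    using finite_positive_lower_bound[OF B, of f] f(1) by auto
  have "P ^ n \<le> real (sepnum (\<alpha> e) n (\<delta> / 2))" for n
  proof -
    let ?D = "zspan (G B n)"
    let ?\<Phi> = "\<lambda>x. restrict (\<lambda>a. chr a x) ?D"
    note pat = card_patterns[OF comp zd D(1) zm.subspace_span, of n]
    define E where "E = inv_into UNIV ?\<Phi> ` range ?\<Phi>"
    have "card E = card ?D"
      unfolding E_def using pat by (simp add: card_image inj_on_inv_into)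
    moreover have "finite E" using pat by (simp add: E_def)
    moreover have "separated (\<alpha> e) n (\<delta> / 2) E"
      unfolding separated_def
    proof (intro ballI impI)
      fix x y assume "x \<in> E" "y \<in> E" "x \<noteq> y"
      moreover have "inv_into UNIV \<Phi> (\<Phi> z) = z" if "z \<in> inv_into UNIV \<Phi> ` range \<Phi>" for z and \<Phi> :: "'x \<Rightarrow> 'x pdual \<Rightarrow> complex"
        using that by (auto simp: f_inv_into_f)
      ultimately have "?\<Phi> x \<noteq> ?\<Phi> y" unfolding E_def by metis
      \<comment> \<open>Characters agreeing at \<open>x\<close> and \<open>y\<close> form a
        subgroup, so a difference on the span already shows on a generator, that is, on some
        \<open>b\<close> in \<open>B\<close> after \<open>k\<close> iterates.\<close>
      then have "\<not> ?D \<subseteq> {a. chr a x = chr a y}" using restrict_ext[of ?D "\<lambda>a. chr a x" "\<lambda>a. chr a y"] by blast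
      moreover have "zm.subspace {a. chr a x = chr a y}"
        by (rule zm_subspace_diffI) (auto simp: chr_0 chr_diff)
      ultimately obtain g where "g \<in> G B n" "chr g x \<noteq> chr g y"
        using zm.span_minimal[of "G B n" "{a. chr a x = chr a y}"] by blast
      then obtain k b where kb: "k < n" "b \<in> B" "chr b ((\<alpha> e ^^ k) x) \<noteq> chr b ((\<alpha> e ^^ k) y)"
        unfolding G_def by (auto simp: chr_dact pow)
      then have "\<not> dist ((\<alpha> e ^^ k) x) ((\<alpha> e ^^ k) y) < \<delta>" using f(2) \<delta>(2) by fastforce
      then show "\<exists>k<n. dist ((\<alpha> e ^^ k) x) ((\<alpha> e ^^ k) y) > \<delta> / 2" using kb(1) \<delta>(1) by (intro exI[of _ k]) auto
    qed
    ultimately have "card ?D \<le> sepnum (\<alpha> e) n (\<delta> / 2)"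
      using sepnum_ge[OF comp continuous_\<alpha> _ \<open>finite E\<close>] \<delta>(1) by simp
    then show ?thesis using D(2)[of n] by linarith
  qed
  then show ?thesis by (rule top_entropy_ge[OF half_gt_zero[OF \<delta>(1)] \<open>P > 0\<close>])
qed

section \<open>Independence of two-variable monomials\<close>

definition mon2 :: "'d \<Rightarrow> 'd \<Rightarrow> nat \<times> nat \<Rightarrow> 'd \<Rightarrow> nat" where
  "mon2 i j kl = (\<lambda>x. if x = i then fst kl else if x = j then snd kl else 0)"

text \<open>In a nontrivial relation modulo \<open>p\<close>, the coefficient of the heaviest
  monomial is invertible; dividing by it would make that monomial reducible. Hence the monomials are
  independent over the field with \<open>p\<close> elements.\<close>

lemma card_free_span:
  assumes p: "prime p" and b: "zmul (int p) b = 0" and ij: "i \<noteq> j"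
    and nored: "\<And>kl. \<not> reducible (mon2 i j kl) b" and I: "finite I"
  shows "p ^ card I \<le> card (zspan ((\<lambda>kl. U (mon2 i j kl) b) ` I))"
proof -
  let ?S = "(\<lambda>kl. U (mon2 i j kl) b) ` I"
  let ?F = "I \<rightarrow>\<^sub>E {0..<int p}"
  let ?h = "\<lambda>c. \<Sum>kl\<in>I. zmul (c kl) (U (mon2 i j kl) b)"
  have Winj: "weight (mon2 i j kl) = weight (mon2 i j kl') \<Longrightarrow> kl = kl'" for kl kl'
    using weight_inj[of "mon2 i j kl" "mon2 i j kl'"] ij
    by (auto simp: mon2_def fun_eq_iff prod_eq_iff split: if_splits)
  have "inj_on ?h ?F"
  proof (rule inj_onI)
    fix c c' assume c: "c \<in> ?F" "c' \<in> ?F" "?h c = ?h c'"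
    define d where "d kl = c kl - c' kl" for kl
    have sum0: "(\<Sum>kl\<in>I. zmul (d kl) (U (mon2 i j kl) b)) = 0"
      using c(3) by (simp add: d_def zm.scale_left_diff_distrib sum_subtractf)
    have dI: "\<bar>d kl\<bar> < int p" if "kl \<in> I" for kl
      using PiE_mem[OF c(1) that] PiE_mem[OF c(2) that] by (auto simp: d_def)
    let ?J = "{kl\<in>I. d kl \<noteq> 0}"
    have "?J = {}"
    proof (rule ccontr)
      assume J: "?J \<noteq> {}"
      have finJ: "finite ?J" using I by simp
      define m where "m = Max ((\<lambda>kl. weight (mon2 i j kl)) ` ?J)"
      have "m \<in> (\<lambda>kl. weight (mon2 i j kl)) ` ?J" unfolding m_def using J finJ by (intro Max_in) auto
      then obtain k0 where k0: "k0 \<in> ?J" "m = weight (mon2 i j k0)" by blast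
      have less: "weight (mon2 i j kl) < weight (mon2 i j k0)" if "kl \<in> ?J - {k0}" for kl
      proof -
        have "weight (mon2 i j kl) \<le> m" unfolding m_def using that finJ by (intro Max_ge) auto
        moreover have "weight (mon2 i j kl) \<noteq> weight (mon2 i j k0)" using Winj that by blast
        ultimately show ?thesis using k0(2) by simp
      qed
      have "coprime (d k0) (int p)"
      proof (rule ccontr)
        assume "\<not> coprime (d k0) (int p)"
        then have "int p dvd d k0" using p by (metis coprime_commute prime_imp_coprime prime_nat_int_transfer)
        then have "\<bar>int p\<bar> \<le> \<bar>d k0\<bar>" using k0(1) by (intro dvd_imp_le_int) auto
        then show False using dI[of k0] k0(1) by auto
      qed
      then obtain e where "[d k0 * e = 1] (mod int p)" using cong_solve_coprime_int by blast
      then obtain t where t: "d k0 * e = 1 + int p * t" by (metis cong_iff_lin mult.commute cong_sym)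
      have kill: "zmul (int p) (U (mon2 i j k0) b) = 0"
        using U.zmul[of "mon2 i j k0" "int p" b] b by (simp add: U.zero)
      have "(\<Sum>kl\<in>I. zmul (d kl) (U (mon2 i j kl) b)) = (\<Sum>kl\<in>?J. zmul (d kl) (U (mon2 i j kl) b))"
        using I by (intro sum.mono_neutral_right) auto
      also have "\<dots> = zmul (d k0) (U (mon2 i j k0) b) + (\<Sum>kl\<in>?J-{k0}. zmul (d kl) (U (mon2 i j kl) b))"
        by (rule sum.remove[OF finJ k0(1)])
      finally have "zmul (d k0) (U (mon2 i j k0) b) = - (\<Sum>kl\<in>?J-{k0}. zmul (d kl) (U (mon2 i j kl) b))"
        using sum0 by (simp add: eq_neg_iff_add_eq_0)
      also have "\<dots> \<in> low (mon2 i j k0) b"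
        unfolding low_def using less
        by (intro zm.span_neg zm.span_sum zm.span_scale zm.span_base imageI) simp
      finally have "zmul e (zmul (d k0) (U (mon2 i j k0) b)) \<in> low (mon2 i j k0) b"
        by (rule zm.subspace_scale[OF subspace_low])
      also have "zmul e (zmul (d k0) (U (mon2 i j k0) b)) = zmul (1 + t * int p) (U (mon2 i j k0) b)"
        using t by (simp add: mult.commute)
      also have "\<dots> = U (mon2 i j k0) b"
        by (simp only: zmul_add_left zmul_mult kill) (simp add: zmul_one)
      finally show False using nored by (simp add: reducible_def)
    qed
    then have "c kl = c' kl" if "kl \<in> I" for kl using that by (cases kl) (auto simp: d_def)
    then show "c = c'" using c(1,2) by (intro PiE_ext)
  qed
  moreover have "?h ` ?F \<subseteq> zspan ?S"
    by (intro image_subsetI zm.span_sum zm.span_scale zm.span_base imageI)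
  moreover have "finite (zspan ?S)"
  proof -
    have "zmul (int p) a = 0" if "a \<in> ?S" for a
      using that b U.zmul[of _ "int p" b] by (auto simp: U.zero)
    then show ?thesis using card_zspan_le[of ?S p] I p by (simp add: prime_gt_0_nat)
  qed
  ultimately have "card ?F \<le> card (zspan ?S)" by (rule card_inj_on_le)
  then show ?thesis using I by (simp add: card_PiE)
qed

text \<open>Otherwise all monomials in the two variables are independent. The \<open>L\<close>
  characters with exponents below \<open>L\<close> in the variable \<open>j\<close> then have p^(nL)
  combinations after \<open>n\<close> translates along \<open>i\<close>, so the entropy along
  \<open>i\<close> is at least L log p for every \<open>L\<close>.\<close>

lemma prime_torsion_reducible:
  assumes entropy: "entropy_rank_one \<alpha>" and p: "prime p" and b: "zmul (int p) b = 0" and ij: "i \<noteq> j"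
  shows "\<exists>m. (\<forall>k. k \<noteq> i \<and> k \<noteq> j \<longrightarrow> m k = 0) \<and> reducible m b"
proof (rule ccontr)
  assume *: "\<not> ?thesis"
  then have nored: "\<not> reducible (mon2 i j kl) b" for kl
    by (metis mon2_def)
  define e where "e = (\<lambda>x. if x = i then 1 else 0 :: int)"
  have "ereal (ln (real p ^ L)) \<le> top_entropy (\<alpha> e)" for L
  proof -
    define B where "B = (\<lambda>l. U (mon2 i j (0, l)) b) ` {..<L}"
    have G: "(\<lambda>(k, b). dact \<alpha> (\<lambda>i. int k * e i) b) ` ({..<n} \<times> B)
        = (\<lambda>kl. U (mon2 i j kl) b) ` ({..<n} \<times> {..<L})" for n
    proof -
      have "(\<lambda>x. int k * e x) + (\<lambda>x. int (mon2 i j (0, l) x)) = (\<lambda>x. int (mon2 i j (k, l) x))" for k l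
        using ij by (auto simp: e_def mon2_def)
      then have "dact \<alpha> (\<lambda>i. int k * e i) (U (mon2 i j (0, l)) b) = U (mon2 i j (k, l)) b" for k l
        by (simp only: U_def u_plus[symmetric])
      then show ?thesis unfolding B_def by (force simp: image_iff)
    qed
    have kill: "zmul (int p) a = 0" if "a \<in> (\<lambda>kl. U (mon2 i j kl) b) ` I" for a I
      using that b U.zmul[of _ "int p" b] by (auto simp: U.zero)
    show ?thesis
    proof (rule entropy_lower_bound[of B])
      show "finite B" by (simp add: B_def)
      show "real p ^ L > 0" using p by (simp add: prime_gt_0_nat)
      show "finite (zspan ((\<lambda>(k, b). dact \<alpha> (\<lambda>i. int k * e i) b) ` ({..<n} \<times> B)))" for n
        unfolding G using card_zspan_le[of _ p, OF _ _ kill] p by (auto simp: prime_gt_0_nat)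
      have "p ^ (n * L) \<le> card (zspan ((\<lambda>kl. U (mon2 i j kl) b) ` ({..<n} \<times> {..<L})))" for n
        using card_free_span[OF p b ij nored, of "{..<n} \<times> {..<L}"] by (simp add: card_cartesian_product)
      then have "real (p ^ (n * L)) \<le> real (card (zspan ((\<lambda>kl. U (mon2 i j kl) b) ` ({..<n} \<times> {..<L}))))" for n
        by (simp only: of_nat_le_iff)
      moreover have "(real p ^ L) ^ n = real (p ^ (n * L))" for n
        by (simp add: power_mult[symmetric] mult.commute)
      ultimately show "(real p ^ L) ^ n \<le> real (card (zspan ((\<lambda>(k, b). dact \<alpha> (\<lambda>i. int k * e i) b) ` ({..<n} \<times> B))))" for n
        unfolding G by simp
    qed
  qed
  moreover have "ln (real p) > 0" using prime_gt_1_nat[OF p] by simp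
  moreover obtain r where "top_entropy (\<alpha> e) \<le> ereal r"
  proof -
    have "top_entropy (\<alpha> e) < \<infinity>" using entropy by (simp add: entropy_rank_one_def)
    then show thesis using that by (cases "top_entropy (\<alpha> e)") auto
  qed
  ultimately have "real L * ln (real p) \<le> r" for L
    using p by (metis ereal_less_eq(3) ln_realpow of_nat_0_less_iff order.trans prime_gt_0_nat)
  moreover obtain L :: nat where "real L * ln (real p) > r"
    using reals_Archimedean3[OF \<open>ln (real p) > 0\<close>] by blast
  ultimately show False by (meson not_le)
qed

end

section \<open>Associated primes and finite generation\<close>

context zd_module
begin

definition ract :: "(('d \<Rightarrow> int) \<Rightarrow> int) \<Rightarrow> 'm \<Rightarrow> 'm" where
  "ract f a = (\<Sum>n\<in>{n. f n \<noteq> 0}. zmul (f n) (u n a))"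

sublocale ract: additive_map "ract f" for f
  by unfold_locales (simp add: ract_def u_add zmul_add_right sum.distrib)

lemma ract_u: "ract f (u n a) = u n (ract f a)"
  by (simp add: ract_def u.sum u.zmul u_commute[of _ n])

lemma ract_commute: "ract f (ract g a) = ract g (ract f a)"
  unfolding ract_def[of g] by (simp add: ract.sum ract.zmul ract_u)

lemma ract_superset:
  assumes "finite S" "{n. f n \<noteq> 0} \<subseteq> S"
  shows "ract f a = (\<Sum>n\<in>S. zmul (f n) (u n a))"
  unfolding ract_def by (rule sum.mono_neutral_left) (use assms in auto)

lemma supp_Rd_mult: "{n. Rd_mult f g n \<noteq> 0} \<subseteq> (\<lambda>(a, b). a + b) ` ({n. f n \<noteq> 0} \<times> {n. g n \<noteq> 0})"
proof
  fix n assume "n \<in> {n. Rd_mult f g n \<noteq> 0}"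
  then have "(\<Sum>a\<in>{a. f a \<noteq> 0}. f a * g (n - a)) \<noteq> 0" by (simp only: Rd_mult_def mem_Collect_eq not_False_eq_True)
  then obtain a where "f a * g (n - a) \<noteq> 0" by (rule sum.not_neutral_contains_not_neutral)
  then have "f a \<noteq> 0" "g (n - a) \<noteq> 0" by auto
  then show "n \<in> (\<lambda>(a, b). a + b) ` ({n. f n \<noteq> 0} \<times> {n. g n \<noteq> 0})"
    by (intro image_eqI[of _ _ "(a, n - a)"]) simp_all
qed

lemma finsupp_Rd_mult: "finsupp f \<Longrightarrow> finsupp g \<Longrightarrow> finsupp (Rd_mult f g)"
  unfolding finsupp_def by (rule finite_subset[OF supp_Rd_mult]) auto

lemma ract_Rd_mult:
  assumes "finsupp f" "finsupp g"
  shows "ract (Rd_mult f g) b = ract f (ract g b)"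
proof -
  let ?F = "{n. f n \<noteq> 0}" and ?G = "{n. g n \<noteq> 0}"
  \<comment> \<open>Cancellation may shrink the support of the product; the sumset is large enough
    in every case.\<close>
  let ?S = "(\<lambda>(a, b). a + b) ` (?F \<times> ?G)"
  have fin: "finite ?F" "finite ?G" "finite ?S" using assms by (auto simp: finsupp_def)
  have "ract (Rd_mult f g) b = (\<Sum>n\<in>?S. \<Sum>a\<in>?F. zmul (f a * g (n - a)) (u n b))"
    by (simp only: ract_superset[OF fin(3) supp_Rd_mult]) (simp add: Rd_mult_def zm.scale_sum_left)
  also have "\<dots> = (\<Sum>a\<in>?F. \<Sum>n\<in>?S. zmul (f a * g (n - a)) (u n b))" by (rule sum.swap)
  also have "\<dots> = (\<Sum>a\<in>?F. \<Sum>m\<in>?G. zmul (f a * g m) (u (a + m) b))"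
  proof (rule sum.cong[OF refl])
    fix a assume a: "a \<in> ?F"
    have "(\<Sum>n\<in>?S. zmul (f a * g (n - a)) (u n b)) = (\<Sum>n\<in>(+) a ` ?G. zmul (f a * g (n - a)) (u n b))"
    proof (rule sum.mono_neutral_right[OF fin(3)])
      show "(+) a ` ?G \<subseteq> ?S" using a by auto
      have "g (n - a) = 0" if "n \<notin> (+) a ` ?G" for n
      proof (rule ccontr)
        assume "g (n - a) \<noteq> 0"
        then have "n \<in> (+) a ` ?G" by (intro image_eqI[of _ _ "n - a"]) auto
        then show False using that by blast
      qed
      then show "\<forall>n\<in>?S - (+) a ` ?G. zmul (f a * g (n - a)) (u n b) = 0" by simp
    qed
    also have "\<dots> = (\<Sum>m\<in>?G. zmul (f a * g m) (u (a + m) b))"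
      by (subst sum.reindex) (auto simp: add_diff_cancel_left')
    finally show "(\<Sum>n\<in>?S. zmul (f a * g (n - a)) (u n b)) = (\<Sum>m\<in>?G. zmul (f a * g m) (u (a + m) b))" .
  qed
  also have "\<dots> = ract f (ract g b)"
    unfolding ract_def by (simp add: u.sum u.zmul zm.scale_sum_right zmul_mult u_plus del: zm.scale_scale)
  finally show ?thesis .
qed

definition invariant_sub :: "'m set \<Rightarrow> bool" where
  "invariant_sub N \<longleftrightarrow> zm.subspace N \<and> (\<forall>n. \<forall>a\<in>N. u n a \<in> N)"

definition gen :: "'m set \<Rightarrow> 'm set" where
  "gen S = zspan {u v a | v a. a \<in> S}"

lemma gen_superset: "a \<in> S \<Longrightarrow> u n a \<in> gen S"
  unfolding gen_def by (intro zm.span_base) blast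

lemma invariant_sub_gen: "invariant_sub (gen S)"
proof -
  have "u n a \<in> gen S" if "a \<in> gen S" for n a
  proof -
    have "u n a \<in> zspan (u n ` {u v a | v a. a \<in> S})"
      using that unfolding gen_def by (rule u.span_image)
    also have "u n ` {u v a | v a. a \<in> S} \<subseteq> {u v a | v a. a \<in> S}"
    proof safe
      fix v a assume "a \<in> S"
      then show "\<exists>v' a'. u n (u v a) = u v' a' \<and> a' \<in> S"
        by (intro exI[of _ "n + v"] exI[of _ a]) (simp only: u_plus)
    qed
    then have "zspan (u n ` {u v a | v a. a \<in> S}) \<subseteq> gen S" unfolding gen_def by (rule zm.span_mono)
    finally show ?thesis .
  qed
  then show ?thesis by (simp add: invariant_sub_def gen_def)
qed

lemma gen_mono: "S \<subseteq> T \<Longrightarrow> gen S \<subseteq> gen T"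
  unfolding gen_def by (intro zm.span_mono) auto

lemma ract_in_gen: "a \<in> S \<Longrightarrow> ract f a \<in> gen S"
  unfolding ract_def gen_def by (intro zm.span_sum zm.span_scale zm.span_base) blast

definition acc :: bool where
  "acc \<longleftrightarrow> (\<forall>N :: nat \<Rightarrow> 'm set. (\<forall>i. invariant_sub (N i)) \<and> mono N \<longrightarrow> (\<exists>k. \<forall>i\<ge>k. N i = N k))"

lemma acc_maximal:
  assumes acc and "\<N> \<noteq> {}" and inv: "\<And>N. N \<in> \<N> \<Longrightarrow> invariant_sub N"
  shows "\<exists>N\<in>\<N>. \<forall>N'\<in>\<N>. N \<subseteq> N' \<longrightarrow> N' = N"
proof (rule ccontr)
  assume "\<not> ?thesis"
  then have "\<forall>N\<in>\<N>. \<exists>N'. N' \<in> \<N> \<and> N \<subset> N'" by blast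
  then obtain h where h: "\<forall>N\<in>\<N>. h N \<in> \<N> \<and> N \<subset> h N" by (rule bchoice[THEN exE])
  obtain N0 where "N0 \<in> \<N>" using assms(2) by blast
  define N where "N i = (h ^^ i) N0" for i
  have N: "N i \<in> \<N>" for i by (induction i) (use \<open>N0 \<in> \<N>\<close> h in \<open>auto simp: N_def\<close>)
  have step: "N i \<subset> N (Suc i)" for i using h N[of i] by (simp add: N_def)
  have "mono N" by (rule incseq_SucI) (use step in blast)
  moreover have "\<forall>i. invariant_sub (N i)" using N inv by blast
  ultimately obtain k where "\<forall>i\<ge>k. N i = N k"
    using assms(1)[unfolded acc_def, THEN spec, of N] by blast
  then have "N (Suc k) = N k" using le_SucI[OF le_refl] by blast
  then show False using step[of k] by simp
qed

text \<open>Adjoining one element to a maximal finitely generated submodule cannot enlarge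
  it.\<close>

lemma acc_finitely_generated:
  assumes acc
  shows "\<exists>S. finite S \<and> gen S = UNIV"
proof -
  have "\<exists>N\<in>gen ` {S. finite S}. \<forall>N'\<in>gen ` {S. finite S}. N \<subseteq> N' \<longrightarrow> N' = N"
    by (rule acc_maximal[OF assms]) (use invariant_sub_gen in auto)
  then obtain S where S: "finite S" "\<And>S'. finite S' \<Longrightarrow> gen S \<subseteq> gen S' \<Longrightarrow> gen S' = gen S" by blast
  have "a \<in> gen S" for a
    using S(2)[of "insert a S"] S(1) gen_mono[of S "insert a S"] gen_superset[of a "insert a S" 0]
    by (auto simp: u_0)
  then show ?thesis using S(1) by blast
qed

lemma ract_Rd_const: "ract (Rd_const c) a = zmul c a"
proof -
  have "ract (Rd_const c) a = (\<Sum>n\<in>{0}. zmul (Rd_const c n) (u n a))"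
    by (rule ract_superset) (auto simp: Rd_const_def)
  then show ?thesis by (simp add: Rd_const_def u_0)
qed

text \<open>Only the chain condition on the module is available, so instead of a maximal annihilator one takes
  \<open>f\<close> with a maximal submodule of elements of \<open>gen {a}\<close> killed by \<open>f\<close>.\<close>

lemma associated_prime_exists:
  assumes acc and a: "a \<noteq> 0"
  shows "\<exists>f. finsupp f \<and> ract f a \<noteq> 0 \<and>
    (\<forall>g h. finsupp g \<longrightarrow> finsupp h \<longrightarrow> ract (Rd_mult g h) (ract f a) = 0 \<longrightarrow>
      ract g (ract f a) = 0 \<or> ract h (ract f a) = 0)"
proof -
  define K where "K f = {b \<in> gen {a}. ract f b = 0}" for f
  let ?\<N> = "K ` {f. finsupp f \<and> ract f a \<noteq> 0}"
  have "finsupp (Rd_const 1)" by (auto simp: finsupp_def Rd_const_def)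
  then have "?\<N> \<noteq> {}" using a ract_Rd_const[of 1 a] by (auto simp: zmul_one)
  moreover have "invariant_sub (K f)" for f
    using invariant_sub_gen[of "{a}"] unfolding invariant_sub_def K_def
    by (auto simp: ract_u u.zero ract.zero ract.diff zm.subspace_0 zm.subspace_diff intro!: zm_subspace_diffI)
  ultimately have "\<exists>N\<in>?\<N>. \<forall>N'\<in>?\<N>. N \<subseteq> N' \<longrightarrow> N' = N"
    by (intro acc_maximal[OF assms(1)]) auto
  then obtain f where f: "finsupp f" "ract f a \<noteq> 0"
    and max: "\<And>f'. finsupp f' \<Longrightarrow> ract f' a \<noteq> 0 \<Longrightarrow> K f \<subseteq> K f' \<Longrightarrow> K f' = K f" by blast
  have "ract g (ract f a) = 0"
    if g: "finsupp g" and h: "finsupp h" and gh: "ract (Rd_mult g h) (ract f a) = 0"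
      and nz: "ract h (ract f a) \<noteq> 0" for g h
  proof -
    have hf: "ract (Rd_mult h f) b = ract h (ract f b)" for b by (rule ract_Rd_mult[OF h f(1)])
    \<comment> \<open>The kernel of the product contains that of \<open>f\<close>, and the product
      does not kill \<open>a\<close>, so maximality forces equality.\<close>
    have "K (Rd_mult h f) = K f"
      by (rule max) (use finsupp_Rd_mult[OF h f(1)] nz in \<open>auto simp: hf K_def ract.zero\<close>)
    moreover have "ract (Rd_mult h f) (ract g a) = ract g (ract h (ract f a))"
      by (simp add: hf ract_commute[of f g] ract_commute[of h g])
    then have "ract g a \<in> K (Rd_mult h f)"
      using gh ract_in_gen[of a "{a}" g] by (simp add: K_def ract_Rd_mult[OF g h])
    ultimately have "ract f (ract g a) = 0" unfolding K_def by blast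
    then show ?thesis by (simp add: ract_commute)
  qed
  then show ?thesis using f by blast
qed

end

section \<open>Torsion primes as associated primes\<close>

context zd_system
begin

lemma Rd_act_chr: "Rd_act \<alpha> f (chr a) = chr (ract f a)"
  by (rule ext) (simp add: Rd_act_def ract_def chr_sum chr_zmul chr_dact)

lemma acc_if_noetherian:
  assumes "noetherian \<alpha>"
  shows acc
  unfolding acc_def
proof (intro allI impI)
  fix N :: "nat \<Rightarrow> 'x pdual set"
  assume N: "(\<forall>i. invariant_sub (N i)) \<and> mono N"
  have sub: "submodule \<alpha> (chr ` K)" if K: "invariant_sub K" for K
  proof -
    have Ks: "zm.subspace K" and Ku: "\<And>n a. a \<in> K \<Longrightarrow> dact \<alpha> n a \<in> K"
      using K by (auto simp: invariant_sub_def)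
    have "ract f a \<in> K" if "a \<in> K" for f a
      unfolding ract_def by (intro zm.subspace_sum zm.subspace_scale Ks Ku that)
    then show ?thesis
      unfolding submodule_def
      using chr zm.subspace_0[OF Ks] zm.subspace_add[OF Ks]
      by (auto simp: Rd_act_chr chr_0[symmetric] chr_add[symmetric])
  qed
  have "mono (\<lambda>i. chr ` N i)" using N by (simp add: mono_def image_mono)
  moreover have "\<forall>i. submodule \<alpha> (chr ` N i)" using N sub by blast
  ultimately have "\<exists>k. \<forall>i\<ge>k. chr ` N i = chr ` N k"
    using assms[unfolded noetherian_def, THEN spec, of "\<lambda>i. chr ` N i"] by simp
  then obtain k where "\<forall>i\<ge>k. chr ` N i = chr ` N k" ..
  moreover have "inj (chr :: 'x pdual \<Rightarrow> _)" by (simp add: inj_def chr_inject)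
  ultimately show "\<exists>k. \<forall>i\<ge>k. N i = N k" by (auto simp: inj_image_eq_iff)
qed

text \<open>Whatever multiple \<open>ract f a\<close> of \<open>a\<close> has a prime annihilator,
  it inherits \<open>p\<close>-torsion from \<open>a\<close>, so the constant \<open>p\<close> lies
  in that annihilator.\<close>

lemma prime_in_primes_of:
  fixes a :: "'x pdual"
  assumes "noetherian \<alpha>" and p: "prime p" and a: "zmul (int p) a = 0" "a \<noteq> 0"
  shows "p \<in> primes_of \<alpha>"
proof -
  obtain f where f: "finsupp f" "ract f a \<noteq> 0"
    and prime: "\<And>g h. finsupp g \<Longrightarrow> finsupp h \<Longrightarrow> ract (Rd_mult g h) (ract f a) = 0 \<Longrightarrow>
      ract g (ract f a) = 0 \<or> ract h (ract f a) = 0"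
    using associated_prime_exists[OF acc_if_noetherian[OF assms(1)] a(2)] by blast
  let ?c = "ract f a"
  have ann: "annihilator \<alpha> (chr ?c) = {g. finsupp g \<and> ract g ?c = 0}"
    by (simp add: annihilator_def Rd_act_chr chr_0[symmetric] chr_inject)
  have const: "finsupp (Rd_const k)" for k by (auto simp: finsupp_def Rd_const_def)
  have one: "(Rd_one :: ('d \<Rightarrow> int) \<Rightarrow> int) = Rd_const 1" by (simp add: Rd_one_def Rd_const_def)
  have "ract Rd_one ?c = ?c" by (subst one) (simp only: ract_Rd_const zmul_one)
  then have "prime_ideal_Rd (annihilator \<alpha> (chr ?c))"
    unfolding prime_ideal_Rd_def ann using prime f(2) by auto
  then have "annihilator \<alpha> (chr ?c) \<in> Ass \<alpha>"
    unfolding Ass_def using chr by blast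
  moreover have "Rd_const (int p) \<in> annihilator \<alpha> (chr ?c)"
    using a(1) const by (simp add: ann ract_Rd_const ract.zmul[symmetric] ract.zero)
  ultimately show ?thesis using p unfolding primes_of_def by blast
qed

section \<open>Mixing\<close>

text \<open>The fibres of a character are translates of its kernel, hence equal in Haar measure, and
  they add up to 1.\<close>

lemma measure_kernel:
  fixes a :: "'x pdual"
  assumes haar: "haar_measure \<mu>"
  shows "measure \<mu> {x. chr a x = 1} = 1 / card (range (chr a))"
proof -
  interpret prob_space \<mu> using haar by (simp add: haar_measure_def)
  have sets: "sets \<mu> = sets borel" using haar by (simp add: haar_measure_def)
  let ?A = "\<lambda>z. {x. chr a x = z}"
  have A: "?A z \<in> sets borel" for z
    by (intro borel_closed closed_Collect_eq continuous_chr continuous_on_const)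
  have fibre: "measure \<mu> (?A z) = measure \<mu> (?A 1)" if z: "z \<in> range (chr a)" for z
  proof -
    obtain y where y: "z = chr a y" using z by blast
    have "?A z = (\<lambda>x. y + x) ` ?A 1"
    proof safe
      fix x assume "z = chr a x"
      then have "chr a (x - y) = 1" by (simp add: chr_diff_arg y chr_nonzero)
      then show "x \<in> (\<lambda>x. y + x) ` ?A 1" by (intro image_eqI[of _ _ "x - y"]) auto
    qed (simp add: y chr_plus)
    then show ?thesis using haar A by (simp add: haar_measure_def measure_def)
  qed
  have fin: "finite (range (chr a))" by (rule finite_range_chr[OF comp zd])
  have space: "space \<mu> = UNIV" using sets_eq_imp_space_eq[OF sets] by simp
  have "(\<Union>z\<in>range (chr a). ?A z) = UNIV" by blast
  then have "1 = measure \<mu> (\<Union>z\<in>range (chr a). ?A z)"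
    using prob_space by (simp only: space)
  also have "\<dots> = (\<Sum>z\<in>range (chr a). measure \<mu> (?A z))"
    using A sets by (intro finite_measure_finite_Union fin) (auto simp: disjoint_family_on_def)
  also have "\<dots> = card (range (chr a)) * measure \<mu> (?A 1)"
    using fibre by simp
  finally have eq: "1 = real (card (range (chr a))) * measure \<mu> (?A 1)" .
  then have "real (card (range (chr a))) \<noteq> 0" by (metis mult_zero_left zero_neq_one)
  then show ?thesis by (rule eq_divide_imp) (simp only: eq[symmetric] mult.commute)
qed

text \<open>The kernel of a fixed character is invariant under the infinitely many multiples of
  \<open>n\<close>, so mixing makes its measure equal to its own square. That measure is the
  reciprocal of the number of values, so there is only one value.\<close>

lemma mixing_no_fixed_character:
  assumes haar: "haar_measure \<mu>" and mix: "mixing \<mu> \<alpha>" and n: "n \<noteq> 0" and fixed: "dact \<alpha> n a = a"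
  shows "a = 0"
proof -
  let ?A = "{x. chr a x = 1}"
  define m where "m j = (\<lambda>i. int j * n i)" for j :: nat
  have "dact \<alpha> (m j) a = a" for j
  proof (induction j)
    case 0
    have "m 0 = 0" by (auto simp: m_def)
    then show ?case by (simp only: u_0)
  next
    case (Suc j)
    have "m (Suc j) = n + m j" by (auto simp: m_def algebra_simps)
    then show ?case by (simp only: u_plus Suc fixed)
  qed
  then have "chr a (\<alpha> (m j) x) = chr a x" for j x by (metis chr_dact)
  then have inv: "?A \<inter> \<alpha> (m j) -` ?A = ?A" for j by auto
  have "?A \<in> sets \<mu>"
    using haar by (auto simp: haar_measure_def intro!: borel_closed closed_Collect_eq continuous_chr continuous_on_const)
  then have lim: "((\<lambda>k. measure \<mu> (?A \<inter> \<alpha> k -` ?A)) \<longlongrightarrow> measure \<mu> ?A * measure \<mu> ?A) cofinite"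
    using mix unfolding mixing_def by blast
  have "measure \<mu> ?A = measure \<mu> ?A * measure \<mu> ?A"
  proof (rule ccontr)
    assume "\<not> ?thesis"
    then have "eventually (\<lambda>k. measure \<mu> (?A \<inter> \<alpha> k -` ?A) \<noteq> measure \<mu> ?A) cofinite"
      using tendsto_imp_eventually_ne[OF lim] by metis
    then have "finite {k. measure \<mu> (?A \<inter> \<alpha> k -` ?A) = measure \<mu> ?A}"
      by (simp add: eventually_cofinite)
    moreover have "range m \<subseteq> {k. measure \<mu> (?A \<inter> \<alpha> k -` ?A) = measure \<mu> ?A}" using inv by auto
    ultimately have "finite (range m)" by (rule finite_subset[rotated])
    moreover have "inj m"
    proof (rule injI)
      fix j k assume jk: "m j = m k"
      obtain i where "n i \<noteq> 0" using n by (auto simp: fun_eq_iff)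
      then show "j = k" using fun_cong[OF jk, of i] by (simp add: m_def)
    qed
    ultimately show False by (simp add: finite_image_iff)
  qed
  then have "card (range (chr a)) = 1"
    using finite_range_chr[OF comp zd, of a] by (simp add: measure_kernel[OF haar] field_simps)
  then obtain z where "range (chr a) = {z}" by (rule card_1_singletonE)
  then have "chr a x = chr a 0" for x by (metis rangeI singletonD)
  then show "a = 0" by (intro pdual_eqI) (simp add: chr_0 chr_at_0)
qed

end

section \<open>Subgroups of finite index\<close>

definition coset :: "('d::finite \<Rightarrow> int) set \<Rightarrow> ('d \<Rightarrow> int) \<Rightarrow> ('d \<Rightarrow> int) set" where
  "coset L v = (\<lambda>w. v + w) ` L"

lemma subspace_if_Zd_subgroup: "Zd_subgroup L \<Longrightarrow> zm.subspace L"
  by (rule zm_subspace_diffI) (auto simp: Zd_subgroup_def)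

lemma coset_eq_iff:
  assumes "zm.subspace L"
  shows "coset L v = coset L w \<longleftrightarrow> v - w \<in> L"
proof
  assume "coset L v = coset L w"
  moreover have "v \<in> coset L v" unfolding coset_def
    by (rule image_eqI[of _ _ 0]) (auto simp only: add_0_right zm.subspace_0[OF assms])
  ultimately obtain l where "l \<in> L" "v = w + l" unfolding coset_def by blast
  then show "v - w \<in> L" by (simp only: add_diff_cancel_left')
next
  have sub: "coset L v \<subseteq> coset L w" if vw: "v - w \<in> L" for v w
  proof
    fix x assume "x \<in> coset L v"
    then obtain l where l: "l \<in> L" "x = v + l" unfolding coset_def by blast
    have "x = w + ((v - w) + l)" by (simp only: l) (simp add: algebra_simps)
    then show "x \<in> coset L w" unfolding coset_def
      using zm.subspace_add[OF assms vw l(1)] by blast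
  qed
  assume vw: "v - w \<in> L"
  then have "w - v \<in> L" using zm.subspace_neg[OF assms vw] by (simp only: minus_diff_eq)
  then show "coset L v = coset L w" using sub vw by blast
qed

lemma Zd_cosets_eq: "Zd_cosets L = range (coset L)"
  unfolding Zd_cosets_def coset_def by (rule refl)

text \<open>The cube [0, s]^d has more lattice points than there are cosets; the difference of two
  congruent ones has coordinates at most \<open>s\<close> in absolute value. This is the source of
  the exponent 1/d.\<close>

lemma short_vector:
  fixes L :: "('d::finite \<Rightarrow> int) set"
  assumes L: "L \<in> finite_index_subgroups" and s: "idx L < (s + 1) ^ CARD('d)"
  obtains n where "n \<in> L" "n \<noteq> 0" "\<And>i. \<bar>n i\<bar> \<le> int s"
proof -
  have sub: "zm.subspace L" and fin: "finite (range (coset L))"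
    using L subspace_if_Zd_subgroup by (auto simp: finite_index_subgroups_def Zd_cosets_eq)
  let ?B = "Pi\<^sub>E (UNIV :: 'd set) (\<lambda>_. {0..int s})"
  have cardB: "card ?B = (s + 1) ^ CARD('d)" by (simp add: card_PiE nat_add_distrib)
  have "card (coset L ` ?B) \<le> idx L"
    unfolding idx_def Zd_cosets_eq by (intro card_mono fin) auto
  then have "\<not> inj_on (coset L) ?B" using pigeonhole[of "coset L" ?B] cardB s by linarith
  then obtain v w where vw: "v \<in> ?B" "w \<in> ?B" "v \<noteq> w" "coset L v = coset L w"
    unfolding inj_on_def by blast
  have "\<bar>(v - w) i\<bar> \<le> int s" for i
    using PiE_mem[OF vw(1), of i] PiE_mem[OF vw(2), of i] by auto
  moreover have "v - w \<noteq> 0" using vw(3) by (simp only: right_minus_eq not_False_eq_True)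
  ultimately show thesis using that[of "v - w"] vw(4) coset_eq_iff[OF sub] by blast
qed

text \<open>Translation by \<open>m\<close> permutes the cosets; summing representatives over all cosets gives the claim.\<close>

lemma idx_multiple_mem:
  assumes L: "L \<in> finite_index_subgroups"
  shows "zmul (int (idx L)) m \<in> L"
proof -
  have sub: "zm.subspace L" and fin: "finite (range (coset L))"
    using L subspace_if_Zd_subgroup by (auto simp: finite_index_subgroups_def Zd_cosets_eq)
  let ?C = "range (coset L)"
  define r where "r c = (SOME v. coset L v = c)" for c
  have r: "coset L (r c) = c" if "c \<in> ?C" for c
    unfolding r_def by (rule someI_ex[of "\<lambda>v. coset L v = c"]) (use that in blast)
  define \<sigma> where "\<sigma> c = coset L (m + r c)" for c
  have "inj_on \<sigma> ?C"
  proof (rule inj_onI)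
    fix c c' assume c: "c \<in> ?C" "c' \<in> ?C" "\<sigma> c = \<sigma> c'"
    then have "(m + r c) - (m + r c') \<in> L" unfolding \<sigma>_def by (simp only: coset_eq_iff[OF sub])
    then have "r c - r c' \<in> L" by (simp only: add_diff_cancel_left)
    then show "c = c'" using r c(1,2) coset_eq_iff[OF sub] by metis
  qed
  moreover have "\<sigma> ` ?C \<subseteq> ?C" by (auto simp: \<sigma>_def)
  ultimately have "bij_betw \<sigma> ?C ?C"
    using fin by (simp add: bij_betw_def endo_inj_surj)
  then have "(\<Sum>c\<in>?C. r (\<sigma> c)) = (\<Sum>c\<in>?C. r c)" by (rule sum.reindex_bij_betw)
  then have "(\<Sum>c\<in>?C. m + r c - r (\<sigma> c)) = (\<Sum>c\<in>?C. m)"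
    by (simp only: sum_subtractf sum.distrib add_diff_cancel_right')
  also have "\<dots> = zmul (int (idx L)) m"
    unfolding idx_def Zd_cosets_eq using zm.sum_constant_scale[of m ?C] by simp
  finally have "zmul (int (idx L)) m = (\<Sum>c\<in>?C. m + r c - r (\<sigma> c))" ..
  also have "\<dots> \<in> L"
  proof (rule zm.subspace_sum[OF sub])
    fix c assume "c \<in> ?C"
    have "coset L (m + r c) = coset L (r (\<sigma> c))"
      using r[of "\<sigma> c"] by (auto simp: \<sigma>_def)
    then show "m + r c - r (\<sigma> c) \<in> L" by (simp only: coset_eq_iff[OF sub])
  qed
  finally show ?thesis .
qed

lemma zmul_fun: "zmul k m = (\<lambda>i. k * (m i :: int))"
proof -
  have "(\<Sum>j<n. m) = (\<lambda>i. int n * m i)" for n :: nat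
    by (induction n) (auto simp: algebra_simps fun_eq_iff)
  then show ?thesis by (auto simp: zmul_def fun_eq_iff algebra_simps)
qed

text \<open>A subgroup of index q contains all q-fold vectors, so it is determined by its members in
  a cube of side q.\<close>

lemma finite_bounded_index:
  "finite {L :: ('d::finite \<Rightarrow> int) set. L \<in> finite_index_subgroups \<and> idx L \<le> Q}"
proof -
  have "finite {L :: ('d \<Rightarrow> int) set. L \<in> finite_index_subgroups \<and> idx L = q}" (is "finite ?X") for q
  proof -
    let ?B = "Pi\<^sub>E (UNIV :: 'd set) (\<lambda>_. {0..int q})"
    have finB: "finite ?B" by (auto intro!: finite_PiE)
    have sub: "L \<subseteq> L'" if L: "L \<in> ?X" "L' \<in> ?X" and eq: "L \<inter> ?B = L' \<inter> ?B" for L L'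
    proof
      fix v assume v: "v \<in> L"
      have s: "zm.subspace L" "zm.subspace L'"
        using L subspace_if_Zd_subgroup by (auto simp: finite_index_subgroups_def)
      have "finite (Zd_cosets L)" "Zd_cosets L \<noteq> {}"
        using L(1) by (auto simp: finite_index_subgroups_def Zd_cosets_def)
      then have q: "q > 0" using L(1) by (auto simp: idx_def card_gt_0_iff)
      define w where "w = (\<lambda>i. v i mod int q)"
      define t where "t = zmul (int q) (\<lambda>i. v i div int q)"
      have t: "t \<in> L" "t \<in> L'"
        using L idx_multiple_mem[of L "\<lambda>i. v i div int q"] idx_multiple_mem[of L' "\<lambda>i. v i div int q"]
        by (simp_all add: t_def)
      have vw: "v = w + t" by (auto simp: w_def t_def zmul_fun)
      then have "w = v - t" by (simp only: add_diff_cancel_right')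
      then have "w \<in> L" using zm.subspace_diff[OF s(1) v t(1)] by simp
      moreover have "w \<in> ?B" using q by (auto simp: w_def less_imp_le)
      ultimately have "w \<in> L'" using eq by blast
      then show "v \<in> L'" using zm.subspace_add[OF s(2) _ t(2)] vw by blast
    qed
    have "inj_on (\<lambda>L. L \<inter> ?B) ?X"
    proof (rule inj_onI)
      fix L L' assume L: "L \<in> ?X" "L' \<in> ?X" "L \<inter> ?B = L' \<inter> ?B"
      show "L = L'" by (rule equalityI[OF sub[OF L] sub[OF L(2,1) L(3)[symmetric]]])
    qed
    then show ?thesis by (rule inj_on_finite[of _ _ "Pow ?B"]) (use finB in auto)
  qed
  then have "finite (\<Union>q\<le>Q. {L :: ('d \<Rightarrow> int) set. L \<in> finite_index_subgroups \<and> idx L = q})" by blast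
  then show ?thesis by (rule finite_subset[rotated]) auto
qed

section \<open>Automorphisms of prime order of finite abelian groups\<close>

text \<open>Every orbit has exactly \<open>q\<close> elements: a shorter period would be coprime to
  \<open>q\<close>, and Bezout would then produce a fixed point. The induction removes one orbit at
  a time.\<close>

lemma card_no_fixed_points_dvd:
  assumes "finite S" "prime q" "\<And>x. x \<in> S \<Longrightarrow> \<phi> x \<in> S" "\<And>x. x \<in> S \<Longrightarrow> (\<phi> ^^ q) x = x"
    "\<And>x. x \<in> S \<Longrightarrow> \<phi> x \<noteq> x"
  shows "q dvd card S"
  using assms(1,3-)
proof (induction S rule: finite_psubset_induct)
  case (psubset S)
  show ?case
  proof (cases "S = {}")
    case False
    then obtain x where x: "x \<in> S" by blast
    define O' where "O' = (\<lambda>i. (\<phi> ^^ i) x) ` {..<q}"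
    have q0: "q > 0" using assms(2) prime_gt_0_nat by blast
    have per: "(\<phi> ^^ q) x = x" by (rule psubset.prems(2)[OF x])
    have orb: "(\<phi> ^^ n) x \<in> O'" for n
      unfolding O'_def using funpow_mod_eq[OF per, of n] q0 by (intro image_eqI[of _ _ "n mod q"]) auto
    have "(\<phi> ^^ n) x \<in> S" for n by (induction n) (auto simp: x psubset.prems(1))
    then have OS: "O' \<subseteq> S" by (auto simp: O'_def)
    have noper: "(\<phi> ^^ k) x \<noteq> x" if "0 < k" "k < q" for k
    proof
      assume k: "(\<phi> ^^ k) x = x"
      have "coprime k q" using assms(2) that by (metis coprime_commute nat_dvd_not_less prime_imp_coprime)
      then obtain a b where ab: "k * a = q * b + 1"
        using coprime_bezout_strong[of k q] prime_gt_1_nat[OF assms(2)] by auto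
      have "(\<phi> ^^ (k * a)) x = x"
        using funpow_mod_eq[OF k, of "k * a"] by simp
      moreover have "(\<phi> ^^ (q * b + 1)) x = (\<phi> ^^ ((q * b + 1) mod q)) x"
        using funpow_mod_eq[OF per, of "q * b + 1"] by simp
      moreover have "(q * b + 1) mod q = 1" using prime_gt_1_nat[OF assms(2)] by (simp add: mod_Suc)
      ultimately show False using ab psubset.prems(3)[OF x] by simp
    qed
    have inj: "inj_on (\<lambda>i. (\<phi> ^^ i) x) {..<q}"
    proof (rule linorder_inj_onI')
      fix i j assume ij: "i \<in> {..<q}" "j \<in> {..<q}" "i < j"
      show "(\<phi> ^^ i) x \<noteq> (\<phi> ^^ j) x"
      proof
        assume "(\<phi> ^^ i) x = (\<phi> ^^ j) x"
        then have "(\<phi> ^^ (q - i)) ((\<phi> ^^ i) x) = (\<phi> ^^ (q - i)) ((\<phi> ^^ j) x)" by simp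
        then have "(\<phi> ^^ (q - i + i)) x = (\<phi> ^^ (q - i + j)) x" by (simp only: funpow_add o_apply)
        also have "q - i + i = q" using ij by simp
        also have "q - i + j = (j - i) + q" using ij by simp
        finally have "(\<phi> ^^ (j - i)) x = x" by (simp only: funpow_add o_apply per)
        moreover have "0 < j - i" "j - i < q" using ij by (auto intro: less_imp_diff_less)
        ultimately show False using noper[of "j - i"] by blast
      qed
    qed
    have cardO: "card O' = q" unfolding O'_def using card_image[OF inj] by simp
    have "q dvd card (S - O')"
    proof (rule psubset.IH)
      show "S - O' \<subset> S" using OS cardO q0 by (metis Diff_Diff_Int Diff_cancel card.empty inf.absorb2 less_irrefl psubsetI Diff_subset)
      show "\<phi> y \<in> S - O'" if y: "y \<in> S - O'" for y
      proof
        show "\<phi> y \<in> S" using y psubset.prems(1) by blast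
        show "\<phi> y \<notin> O'"
        proof
          assume "\<phi> y \<in> O'"
          then obtain i where i: "\<phi> y = (\<phi> ^^ i) x" unfolding O'_def by blast
          \<comment> \<open>On \<open>S\<close> the iterate of order \<open>q - 1\<close> inverts
            \<open>\<phi>\<close>, so a point mapped into the orbit already lies in it.\<close>
          have "y = (\<phi> ^^ (q - 1 + 1)) y" using psubset.prems(2)[of y] y q0 by simp
          also have "\<dots> = (\<phi> ^^ (q - 1 + i)) x" by (simp only: funpow_add o_apply) (simp add: i)
          finally show False using orb y by simp
        qed
      qed
    qed (use psubset.prems in auto)
    moreover have "card S = card (S - O') + q"
      using card_Diff_subset[OF _ OS] card_mono[OF psubset.hyps(1) OS] cardO psubset.hyps(1) OS finite_subset by fastforce
    ultimately show ?thesis by simp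
  qed simp
qed

context comm_group
begin

text \<open>For a second prime divisor r of the order, Sylow gives a subgroup of order r, whose
  nontrivial elements would have an order dividing both r and a power of \<open>p\<close>.\<close>

lemma card_p_power_torsion_subgroup:
  assumes fin: "finite (carrier G)" and p: "prime p" and P: "subgroup P G"
    and tors: "\<And>x. x \<in> P \<Longrightarrow> \<exists>k::nat. x [^] (p ^ k) = \<one>"
  shows "\<exists>a. card P = p ^ a"
proof -
  have finP: "finite P" using P fin subgroup.subset finite_subset by blast
  interpret P: group "G\<lparr>carrier := P\<rparr>" using P by (rule subgroup_imp_group)
  have P0: "card P > 0" using finP subgroup.one_closed[OF P] by (auto simp: card_gt_0_iff)
  have "r = p" if r: "prime r" "r dvd card P" for r
  proof (rule ccontr)
    assume rp: "r \<noteq> p"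
    obtain m where m: "card P = r ^ 1 * m" using r(2) by (auto elim: dvdE)
    obtain H where H: "subgroup H (G\<lparr>carrier := P\<rparr>)" "card H = r ^ 1"
      using sylow_thm[OF r(1) P.is_group, of 1 m] m finP by (auto simp: order_def)
    have HG: "subgroup H G" using incl_subgroup[OF P H(1)] .
    interpret H: group "G\<lparr>carrier := H\<rparr>" using HG by (rule subgroup_imp_group)
    have "H \<noteq> {\<one>}" using H(2) r(1) prime_gt_1_nat[of r] by auto
    then obtain h where h: "h \<in> H" "h \<noteq> \<one>" using subgroup.one_closed[OF HG] by blast
    have hG: "h \<in> carrier G" using h(1) HG subgroup.mem_carrier by metis
    have "h [^]\<^bsub>G\<lparr>carrier := H\<rparr>\<^esub> order (G\<lparr>carrier := H\<rparr>) = \<one>\<^bsub>G\<lparr>carrier := H\<rparr>\<^esub>"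
      by (rule H.pow_order_eq_1) (use h in simp)
    then have hr: "h [^] r = \<one>" using H(2) by (simp add: order_def nat_pow_consistent[symmetric])
    have "h \<in> P" using h(1) subgroup.subset[OF H(1)] by auto
    then obtain k :: nat where hp: "h [^] (p ^ k) = \<one>" using tors by blast
    have "coprime r (p ^ k)" using p r(1) rp by (simp add: primes_coprime)
    moreover have "ord h dvd r" "ord h dvd p ^ k" using hr hp hG pow_eq_id by blast+
    ultimately have "ord h = 1" using coprime_common_divisor_nat by blast
    then show False using h(2) hG pow_ord_eq_1[OF hG] by simp
  qed
  then have "\<not> (\<exists>r\<in>prime_factors (card P). r \<noteq> p)" by (auto simp: in_prime_factors_iff)
  then show ?thesis using Ex_other_prime_factor[of "card P" p] P0 p by auto
qed

text \<open>Outside its fixed subgroup \<open>Q\<close>, the automorphism moves every element of the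
  p-primary part \<open>P\<close>, so \<open>q\<close> divides the difference of their orders, two
  powers of \<open>p\<close>. The smaller power cancels modulo \<open>q\<close>.\<close>

lemma prime_order_automorphism_bound:
  assumes fin: "finite (carrier G)" and hom: "\<phi> \<in> hom G G" and q: "prime q"
    and per: "\<And>x. x \<in> carrier G \<Longrightarrow> (\<phi> ^^ q) x = x"
    and p: "prime p" "p \<noteq> q" and x0: "x0 \<in> carrier G" "x0 [^] (p ^ k :: nat) = \<one>" "\<phi> x0 \<noteq> x0"
  shows "\<exists>e>0. p ^ e \<le> card (carrier G) \<and> [p ^ e = 1] (mod q)"
proof -
  interpret \<phi>: group_hom G G \<phi> by unfold_locales (rule hom)
  define P where "P = {x \<in> carrier G. \<exists>k::nat. x [^] (p ^ k) = \<one>}"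
  define Q where "Q = {x \<in> P. \<phi> x = x}"
  have up: "x [^] (p ^ (k + l)) = \<one>" if "x \<in> carrier G" "x [^] (p ^ k) = \<one>" for x and k l :: nat
    using that by (simp add: power_add nat_pow_pow[symmetric])
  have P: "subgroup P G"
  proof (rule subgroupI)
    show "P \<noteq> {}" by (auto simp: P_def intro!: exI[of _ \<one>])
    show "inv a \<in> P" if "a \<in> P" for a
      using that by (auto simp: P_def nat_pow_inv)
    show "a \<otimes> b \<in> P" if ab: "a \<in> P" "b \<in> P" for a b
    proof -
      obtain k l :: nat where kl: "a [^] (p ^ k) = \<one>" "b [^] (p ^ l) = \<one>" and c: "a \<in> carrier G" "b \<in> carrier G"
        using ab by (auto simp: P_def)
      have "(a \<otimes> b) [^] (p ^ (k + l)) = \<one>"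
        using up[OF c(1) kl(1), of l] up[OF c(2) kl(2), of k] c by (simp add: nat_pow_distrib add.commute)
      then show ?thesis using c by (auto simp: P_def)
    qed
  qed (auto simp: P_def)
  have Q: "subgroup Q G"
  proof (rule subgroupI)
    show "Q \<noteq> {}" using subgroup.one_closed[OF P] by (auto simp: Q_def intro!: exI[of _ \<one>])
    show "inv a \<in> Q" if "a \<in> Q" for a
      using that subgroup.m_inv_closed[OF P] subgroup.mem_carrier[OF P] by (auto simp: Q_def)
    show "a \<otimes> b \<in> Q" if "a \<in> Q" "b \<in> Q" for a b
      using that subgroup.m_closed[OF P] subgroup.mem_carrier[OF P] by (auto simp: Q_def)
  qed (auto simp: Q_def P_def)
  obtain a where a: "card P = p ^ a"
    using card_p_power_torsion_subgroup[OF fin p(1) P] by (auto simp: P_def)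
  obtain b where b: "card Q = p ^ b"
    using card_p_power_torsion_subgroup[OF fin p(1) Q] by (auto simp: P_def Q_def)
  have finP: "finite P" using fin by (simp add: P_def)
  have "x0 \<in> P - Q" using x0 by (auto simp: P_def Q_def)
  then have "Q \<subset> P" by (auto simp: Q_def)
  then have "p ^ b < p ^ a" using psubset_card_mono[OF finP] a b by metis
  then have ab: "b < a" using prime_gt_1_nat[OF p(1)] by simp
  \<comment> \<open>Injectivity keeps moved elements moved, so \<open>P - Q\<close> is mapped to
    itself.\<close>
  have inj: "x = y" if "x \<in> carrier G" "y \<in> carrier G" "\<phi> x = \<phi> y" for x y
  proof -
    have "(\<phi> ^^ Suc (q - 1)) x = (\<phi> ^^ Suc (q - 1)) y" using that(3) by (simp only: funpow_Suc_right o_apply)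
    then show ?thesis using per that(1,2) prime_gt_0_nat[OF q] by simp
  qed
  have "q dvd card (P - Q)"
  proof (rule card_no_fixed_points_dvd[OF _ q, of _ \<phi>])
    show "\<phi> x \<in> P - Q" if x: "x \<in> P - Q" for x
    proof -
      have xG: "x \<in> carrier G" using x by (auto simp: P_def)
      obtain k :: nat where "x [^] (p ^ k) = \<one>" using x by (auto simp: P_def)
      then have "\<phi> x [^] (p ^ k) = \<one>" using \<phi>.hom_nat_pow[OF xG, of "p ^ k"] by simp
      then have "\<phi> x \<in> P" using xG by (auto simp: P_def)
      moreover have "\<phi> (\<phi> x) \<noteq> \<phi> x" using inj[of "\<phi> x" x] x xG by (auto simp: Q_def)
      ultimately show ?thesis by (simp add: Q_def)
    qed
  qed (use finP per in \<open>auto simp: P_def Q_def\<close>)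
  moreover have "card (P - Q) = p ^ a - p ^ b"
    using card_Diff_subset[of Q P] finP \<open>Q \<subset> P\<close> a b finite_subset by (metis psubset_imp_subset)
  ultimately have "[p ^ a = p ^ b] (mod q)"
    using ab prime_gt_0_nat[OF p(1)] by (simp add: cong_iff_dvd_diff cong_altdef_nat power_increasing less_imp_le)
  then have "[p ^ b * p ^ (a - b) = p ^ b * 1] (mod q)"
    using ab by (simp add: power_add[symmetric])
  moreover have "coprime (p ^ b) q" using p q by (simp add: primes_coprime)
  ultimately have "[p ^ (a - b) = 1] (mod q)" using cong_mult_lcancel_nat by blast
  moreover have "p ^ (a - b) \<le> card (carrier G)"
  proof -
    have "p ^ (a - b) \<le> p ^ a" using prime_gt_0_nat[OF p(1)] by (intro power_increasing) auto
    also have "\<dots> \<le> card (carrier G)" unfolding a[symmetric] using fin by (intro card_mono) (auto simp: P_def)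
    finally show ?thesis .
  qed
  ultimately show ?thesis using ab by (intro exI[of _ "a - b"]) auto
qed

end

section \<open>Points fixed by a subgroup of prime index\<close>

text \<open>An element is an integral combination of its primary components; if all of them were in
  the subgroup, so would be the element.\<close>

lemma p_component_exists:
  fixes a :: "'a::ab_group_add"
  assumes Z: "zm.subspace Z" and "n > 0" "zmul (int n) a = 0" "a \<notin> Z"
  shows "\<exists>p k b. prime p \<and> zmul (int (p ^ k)) b = 0 \<and> b \<notin> Z"
  using assms(2-)
proof (induction n arbitrary: a rule: less_induct)
  case (less n)
  have "n \<noteq> 1" using less.prems zm.subspace_0[OF Z] by (auto simp: zmul_one)
  then obtain p where p: "prime p" "p dvd n" using prime_factor_nat by blast
  obtain n' where n': "n = p ^ multiplicity p n * n'" "\<not> p dvd n'"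
    using multiplicity_decompose'[of n p] less.prems(1) p(1) not_prime_unit by (metis not_gr_zero)
  define k where "k = multiplicity p n"
  have nk: "n = p ^ k * n'" using n'(1) by (simp add: k_def)
  have "k > 0"
  proof (rule gr0I)
    assume "k = 0"
    then show False using nk p(2) n'(2) by simp
  qed
  then have "p ^ k > 1" by (rule one_less_power[OF prime_gt_1_nat[OF p(1)]])
  have "n' > 0" using n'(2) by (intro gr0I) auto
  with \<open>p ^ k > 1\<close> have n'n: "n' < n" by (subst nk) simp
  have "coprime (int (p ^ k)) (int n')"
    using p(1) n'(2) by (simp add: prime_imp_coprime)
  then obtain x where "[int (p ^ k) * x = 1] (mod int n')" using cong_solve_coprime_int by blast
  then obtain t where t: "int (p ^ k) * x = 1 + int n' * t" by (metis cong_iff_lin cong_sym)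
  have "zmul (x * int (p ^ k)) a = zmul (1 + t * int n') a"
    using t by (simp only: mult.commute)
  \<comment> \<open>By Bezout \<open>a\<close> combines a multiple of order dividing
    \<open>n'\<close> and one of order dividing \<open>p ^ k\<close>, so at least one of the two is
    outside \<open>Z\<close>.\<close>
  then have a: "a = zmul x (zmul (int (p ^ k)) a) - zmul t (zmul (int n') a)"
    by (simp only: zmul_add_left zmul_mult zmul_one) simp
  show ?case
  proof (cases "zmul (int n') a \<in> Z")
    case False
    have "zmul (int (p ^ k)) (zmul (int n') a) = 0"
      using less.prems(2) by (simp only: nk of_nat_mult zmul_mult)
    then show ?thesis using p(1) False by blast
  next
    case True
    then have "zmul (int (p ^ k)) a \<notin> Z"
      using a less.prems(3) zm.subspace_diff[OF Z] zm.subspace_scale[OF Z] by metis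
    moreover have "zmul (int n') (zmul (int (p ^ k)) a) = 0"
      using less.prems(2) by (simp only: nk of_nat_mult mult.commute[of "int (p ^ k)"] zmul_mult)
    ultimately show ?thesis using less.IH[OF n'n \<open>n' > 0\<close>] by blast
  qed
qed

lemma prime_torsion_exists:
  fixes b :: "'a::ab_group_add"
  assumes "zmul (int (p ^ k)) b = 0" "b \<noteq> 0"
  shows "\<exists>c::'a. c \<noteq> 0 \<and> zmul (int p) c = 0"
  using assms
proof (induction k)
  case 0
  then show ?case by (simp add: zmul_one)
next
  case (Suc k)
  show ?case
  proof (cases "zmul (int (p ^ k)) b = 0")
    case False
    have "zmul (int p) (zmul (int (p ^ k)) b) = 0"
      using Suc.prems(1) by (simp only: power_Suc of_nat_mult zmul_mult)
    then show ?thesis using False by blast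
  qed (use Suc in blast)
qed

text \<open>Taking \<open>t\<close>-th roots makes the constant \<open>B\<close> disappear as
  \<open>t\<close> grows.\<close>

lemma le_if_powers_le:
  fixes x K B :: nat
  assumes "K > 0" "\<And>t. x ^ t \<le> B * K ^ t"
  shows "x \<le> K"
proof (rule ccontr)
  assume "\<not> x \<le> K"
  then have "real x / real K > 1" using assms(1) by simp
  then obtain t where t: "real B < (real x / real K) ^ t" using real_arch_pow by blast
  have "real (x ^ t) \<le> real (B * K ^ t)" using assms(2) by (simp only: of_nat_le_iff)
  then show False using t assms(1) by (simp add: power_divide field_simps)
qed

context zd_module
begin

lemma box_mono:
  assumes "R \<le> R'"
  shows "box S R \<subseteq> box S R'"
proof -
  have "x \<le> int R'" if "x \<le> int R" for x using that assms by linarith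
  then show ?thesis unfolding box_def by (intro zm.span_mono Collect_mono) blast
qed

lemma u_box:
  assumes "a \<in> box S R" "\<And>i. \<bar>n i\<bar> \<le> int s"
  shows "u n a \<in> box S (R + s)"
proof -
  have "u n a \<in> zspan (u n ` {u v a | v a. a \<in> S \<and> (\<forall>i. \<bar>v i\<bar> \<le> int R)})"
    using assms(1) unfolding box_def by (rule u.span_image)
  also have "u n ` {u v a | v a. a \<in> S \<and> (\<forall>i. \<bar>v i\<bar> \<le> int R)} \<subseteq> {u v a | v a. a \<in> S \<and> (\<forall>i. \<bar>v i\<bar> \<le> int (R + s))}"
  proof safe
    fix v :: "'d \<Rightarrow> int" and a assume a: "a \<in> S" and v: "\<forall>i. \<bar>v i\<bar> \<le> int R"
    have nv: "\<bar>(n + v) i\<bar> \<le> int (R + s)" for i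
      using v[rule_format, of i] assms(2)[of i] by simp
    show "\<exists>v' a'. u n (u v a) = u v' a' \<and> a' \<in> S \<and> (\<forall>i. \<bar>v' i\<bar> \<le> int (R + s))"
      by (intro exI[of _ "n + v"] exI[of _ a] conjI allI u_plus[symmetric] a nv)
  qed
  then have "zspan (u n ` {u v a | v a. a \<in> S \<and> (\<forall>i. \<bar>v i\<bar> \<le> int R)}) \<subseteq> box S (R + s)"
    unfolding box_def by (rule zm.span_mono)
  finally show ?thesis .
qed

lemma gen_in_box: "a \<in> gen S \<Longrightarrow> \<exists>R. a \<in> box S R"
  unfolding gen_def
proof (induction rule: zm.span_induct_alt)
  case base
  then show ?case by (auto simp: box_def zm.span_zero)
next
  case (step c x y)
  then obtain R where R: "y \<in> box S R" by blast
  obtain v a where x: "x = u v a" "a \<in> S" using step(1) by blast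
  define R' where "R' = Max (range (\<lambda>i. nat \<bar>v i\<bar>))"
  have "nat \<bar>v i\<bar> \<le> R'" for i unfolding R'_def by (rule Max_ge) auto
  then have v: "\<bar>v i\<bar> \<le> int R'" for i by (simp only: nat_le_iff)
  then have "x \<in> box S R'" unfolding box_def x(1) using x(2) by (intro zm.span_base) blast
  then have "zmul c x + y \<in> box S (max R R')"
    using R box_mono[of R "max R R'" S] box_mono[of R' "max R R'" S]
    by (auto simp: box_def intro!: zm.span_add zm.span_scale)
  then show ?case by blast
qed

end

section \<open>Characters restricted to fixed points\<close>

context zd_system
begin

text \<open>For \<open>F\<close> inside the points fixed by \<open>\<alpha> n\<close>, the
  restrictions form a quotient of M/(u^n - 1)M. Extensional functions make equality mean agreement
  on \<open>F\<close>.\<close>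

definition restriction :: "'x set \<Rightarrow> 'x pdual \<Rightarrow> 'x \<Rightarrow> complex" where
  "restriction F a = restrict (chr a) F"

lemma restriction_add_trivial: "\<forall>x\<in>F. chr c x = 1 \<Longrightarrow> restriction F (a + c) = restriction F a"
  by (auto simp: restriction_def chr_add)

text \<open>The image of \<open>u\<^sup>n - 1\<close> restricts trivially to \<open>F\<close>, so each restriction of a character in
  \<open>box S R\<close> has at least \<open>card (box S R')\<close> preimages in \<open>box S (R' + s)\<close>; iterating, linear growth
  bounds the number of restrictions.\<close>

lemma card_restrictions:
  assumes growth: "\<And>R. finite (box S R) \<and> card (box S R) \<le> N ^ (C * (R + 1))" and N: "N > 0"
    and gen: "gen S = UNIV"
    and inj: "\<And>a. dact \<alpha> n a = a \<Longrightarrow> a = 0"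
    and n: "\<And>i. \<bar>n i\<bar> \<le> int s" and F: "\<And>x. x \<in> F \<Longrightarrow> \<alpha> n x = x"
  shows "finite (range (restriction F)) \<and> card (range (restriction F)) \<le> N ^ (C * s)"
proof -
  let ?A = "\<lambda>R. restriction F ` box S R"
  have finA: "finite (?A R)" for R using growth by blast
  have step: "card (?A R) * card (box S R') \<le> card (box S (R' + s))" if R: "R \<le> R'" for R R'
  proof -
    define r where "r = inv_into (box S R) (restriction F)"
    have r: "r f \<in> box S R" "restriction F (r f) = f" if "f \<in> ?A R" for f
      using that unfolding r_def by (auto intro: inv_into_into f_inv_into_f)
    \<comment> \<open>The restriction of \<open>h (f, b)\<close> recovers \<open>f\<close>, and then
      injectivity of u^n - 1 recovers \<open>b\<close>.\<close>
    define h where "h = (\<lambda>(f, b). r f + (dact \<alpha> n b - b))"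
    have resth: "restriction F (h (f, b)) = f" if "f \<in> ?A R" for f b
    proof -
      have "restriction F (r f + (dact \<alpha> n b - b)) = restriction F (r f)"
        by (rule restriction_add_trivial) (simp add: chr_diff chr_dact F chr_nonzero)
      then show ?thesis using r(2)[OF that] by (simp add: h_def)
    qed
    have "inj_on h (?A R \<times> box S R')"
    proof (rule inj_onI)
      fix z z' assume z: "z \<in> ?A R \<times> box S R'" "z' \<in> ?A R \<times> box S R'" "h z = h z'"
      obtain f b f' b' where zz: "z = (f, b)" "z' = (f', b')" by (cases z, cases z')
      have fb: "f \<in> ?A R" "f' \<in> ?A R" "h (f, b) = h (f', b')" using z by (auto simp: zz)
      have ff: "f = f'" using resth[OF fb(1), of b] resth[OF fb(2), of b'] fb(3) by simp
      then have "dact \<alpha> n b - b = dact \<alpha> n b' - b'" using fb(3) by (simp add: h_def)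
      then have "dact \<alpha> n (b - b') = b - b'" by (simp add: u.diff algebra_simps)
      then have "b - b' = 0" by (rule inj)
      then show "z = z'" using ff by (simp add: zz)
    qed
    moreover have "h ` (?A R \<times> box S R') \<subseteq> box S (R' + s)"
    proof (rule image_subsetI)
      fix z assume z: "z \<in> ?A R \<times> box S R'"
      obtain f b where zz: "z = (f, b)" by (cases z)
      have fb: "f \<in> ?A R" "b \<in> box S R'" using z by (auto simp: zz)
      have "r f \<in> box S (R' + s)" "dact \<alpha> n b \<in> box S (R' + s)" "b \<in> box S (R' + s)"
        using r(1)[OF fb(1)] u_box[OF fb(2) n] fb(2) box_mono[of R "R' + s" S] box_mono[of R' "R' + s" S] R by auto
      then show "h z \<in> box S (R' + s)"
        by (auto simp: h_def zz box_def intro!: zm.span_add zm.span_diff)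
    qed
    ultimately have "card (?A R \<times> box S R') \<le> card (box S (R' + s))"
      using growth by (intro card_inj_on_le) auto
    then show ?thesis by (simp add: card_cartesian_product)
  qed
  have bound: "card (?A R) \<le> N ^ (C * s)" for R
  proof (rule le_if_powers_le[where B = "N ^ (C * (R + 1))"])
    show "card (?A R) ^ t \<le> N ^ (C * (R + 1)) * (N ^ (C * s)) ^ t" for t
    proof -
      have "card (?A R) ^ t \<le> card (box S (R + t * s))"
      proof (induction t)
        case 0
        have "0 \<in> box S R" by (simp add: box_def zm.span_zero)
        then have "card (box S R) > 0" using growth[of R] card_gt_0_iff by blast
        then show ?case by simp
      next
        case (Suc t)
        have "card (?A R) ^ Suc t \<le> card (?A R) * card (box S (R + t * s))" using Suc by simp
        also have "\<dots> \<le> card (box S (R + t * s + s))" by (rule step) simp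
        finally show ?case by (simp add: algebra_simps)
      qed
      also have "\<dots> \<le> N ^ (C * (R + t * s + 1))" using growth by blast
      also have "\<dots> = N ^ (C * (R + 1)) * (N ^ (C * s)) ^ t"
        by (simp add: power_add[symmetric] power_mult[symmetric] algebra_simps)
      finally show ?thesis .
    qed
  qed (use N in simp)
  \<comment> \<open>The bound is uniform in \<open>R\<close>, so the increasing images reach a
    maximal size and stop growing; that image contains all restrictions.\<close>
  have "\<exists>R. \<forall>R'. card (?A R') \<le> card (?A R)"
    using ex_has_greatest_nat[of "\<lambda>_. True" 0 "\<lambda>R. card (?A R)" "Suc (N ^ (C * s))"] bound
    by (auto simp: less_Suc_eq_le)
  then obtain R where R: "\<And>R'. card (?A R') \<le> card (?A R)" by blast
  have "range (restriction F) \<subseteq> ?A R"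
  proof safe
    fix a
    obtain R' where "a \<in> box S R'" using gen gen_in_box[of a S] by auto
    then have "restriction F a \<in> ?A (max R R')" using box_mono[of R' "max R R'" S] by auto
    moreover have "?A R = ?A (max R R')"
      using finA R box_mono[of R "max R R'" S] by (intro card_seteq) auto
    ultimately show "restriction F a \<in> ?A R" by simp
  qed
  then have "range (restriction F) = ?A R" by blast
  then show ?thesis using bound finA by simp
qed

text \<open>An explicit group record, the form in which the count for automorphisms of prime order
  is available.\<close>

definition restriction_group :: "'x set \<Rightarrow> ('x \<Rightarrow> complex) monoid" where
  "restriction_group F = \<lparr>carrier = range (restriction F), mult = (\<lambda>f g. \<lambda>x\<in>F. f x * g x), one = (\<lambda>x\<in>F. 1)\<rparr>"

lemma restriction_group_mult: "restriction F a \<otimes>\<^bsub>restriction_group F\<^esub> restriction F b = restriction F (a + b)"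
  by (auto simp: restriction_group_def restriction_def chr_add)

lemma restriction_group_one: "\<one>\<^bsub>restriction_group F\<^esub> = restriction F 0"
  by (auto simp: restriction_group_def restriction_def chr_0)

lemma restriction_group_carrier: "carrier (restriction_group F) = range (restriction F)"
  by (simp add: restriction_group_def)

lemma comm_group_restriction_group: "comm_group (restriction_group F)"
proof (rule comm_groupI)
  fix f assume "f \<in> carrier (restriction_group F)"
  then obtain a where a: "f = restriction F a" by (auto simp: restriction_group_carrier)
  show "\<exists>g\<in>carrier (restriction_group F). g \<otimes>\<^bsub>restriction_group F\<^esub> f = \<one>\<^bsub>restriction_group F\<^esub>"
    by (rule bexI[of _ "restriction F (- a)"]) (auto simp: a restriction_group_mult restriction_group_one restriction_group_carrier)
qed (auto simp: restriction_group_carrier restriction_group_mult restriction_group_one ac_simps)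

lemma restriction_group_pow: "restriction F a [^]\<^bsub>restriction_group F\<^esub> (n::nat) = restriction F (zmul (int n) a)"
proof -
  interpret comm_group "restriction_group F" by (rule comm_group_restriction_group)
  show ?thesis
  proof (induction n)
    case 0
    then show ?case by (simp add: restriction_group_one)
  next
    case (Suc n)
    then show ?case by (simp only: nat_pow_Suc restriction_group_mult zmul_of_nat_Suc add.commute)
  qed
qed

text \<open>The map induced by \<open>\<alpha> m\<close> on restrictions has \<open>q\<close>-th
  power the identity, because the \<open>q\<close>-fold of \<open>m\<close> lies in
  \<open>L\<close>, where q is the index. Separation by characters shows that it moves an element of
  prime power order.\<close>

lemma nonfixed_point_bound:
  assumes growth: "\<And>R. finite (box S R) \<and> card (box S R) \<le> N ^ (C * (R + 1))" and N: "N > 0"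
    and gen: "gen S = UNIV" and noeth: "noetherian \<alpha>"
    and inj: "\<And>n a. n \<noteq> 0 \<Longrightarrow> dact \<alpha> n a = a \<Longrightarrow> a = 0"
    and L: "L \<in> finite_index_subgroups" and q: "prime (idx L)" "idx L \<notin> primes_of \<alpha>"
    and s: "idx L < (s + 1) ^ CARD('d)"
    and x: "\<And>n. n \<in> L \<Longrightarrow> \<alpha> n x = x" "\<alpha> m x \<noteq> x"
  shows "\<exists>p\<in>primes_of \<alpha>. \<exists>e>0. p ^ e \<le> N ^ (C * s) \<and> [p ^ e = 1] (mod idx L)"
proof -
  define F where "F = {x. \<forall>n\<in>L. \<alpha> n x = x}"
  have xF: "x \<in> F" using x by (simp add: F_def)
  have inv: "\<alpha> k y \<in> F" if "y \<in> F" for k y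
    using that \<alpha>_plus[of _ k y, symmetric] \<alpha>_plus[of k _ y] by (simp add: F_def add.commute)
  obtain n where n: "n \<in> L" "n \<noteq> 0" "\<And>i. \<bar>n i\<bar> \<le> int s" using short_vector[OF L s] by metis
  have card: "finite (range (restriction F)) \<and> card (range (restriction F)) \<le> N ^ (C * s)"
    by (rule card_restrictions[OF growth N gen inj[OF n(2)] n(3)]) (use n(1) in \<open>auto simp: F_def\<close>)
  \<comment> \<open>These characters do not see that \<open>x\<close> is moved. They form a proper
    subgroup, so some character of prime power order lies outside it.\<close>
  define Z where "Z = {a. chr a (\<alpha> m x) = chr a x}"
  have Z: "zm.subspace Z" by (rule zm_subspace_diffI) (auto simp: Z_def chr_0 chr_diff)
  obtain a where "chr a (\<alpha> m x - x) \<noteq> 1"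
    using characters_separate[OF comp zd, of "\<alpha> m x - x"] x(2) by auto
  then have "a \<notin> Z" by (simp add: Z_def chr_diff_arg chr_nonzero)
  moreover obtain k where "k > 0" "zmul (int k) a = 0" using pdual_torsion[OF comp zd] by blast
  ultimately obtain p k b where b: "prime p" "zmul (int (p ^ k)) b = 0" "b \<notin> Z"
    using p_component_exists[OF Z] by blast
  have "b \<noteq> 0" using b(3) zm.subspace_0[OF Z] by auto
  then obtain c :: "'x pdual" where "c \<noteq> 0" "zmul (int p) c = 0" using prime_torsion_exists[OF b(2)] by blast
  then have pP: "p \<in> primes_of \<alpha>" by (intro prime_in_primes_of[OF noeth b(1)])
  define \<phi> where "\<phi> f = (\<lambda>y\<in>F. f (\<alpha> m y))" for f :: "'x \<Rightarrow> complex"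
  have \<phi>: "\<phi> (restriction F a) = restriction F (dact \<alpha> m a)" for a
    by (auto simp: \<phi>_def restriction_def chr_dact inv)
  have pow: "(\<phi> ^^ t) (restriction F a) = restriction F (dact \<alpha> (zmul (int t) m) a)" for t a
  proof (induction t)
    case 0
    then show ?case by (simp only: of_nat_0 zmul_zero_left u_0 funpow.simps id_apply)
  next
    case (Suc t)
    then show ?case by (simp only: funpow.simps o_apply \<phi> zmul_of_nat_Suc u_plus)
  qed
  have triv: "restriction F (dact \<alpha> l a) = restriction F a" if "l \<in> L" for l a
    using that by (auto simp: restriction_def chr_dact F_def)
  interpret comm_group "restriction_group F" by (rule comm_group_restriction_group)
  have "\<exists>e>0. p ^ e \<le> card (carrier (restriction_group F)) \<and> [p ^ e = 1] (mod idx L)"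
  proof (rule prime_order_automorphism_bound)
    show "finite (carrier (restriction_group F))" using card by (simp add: restriction_group_carrier)
    show "\<phi> \<in> hom (restriction_group F) (restriction_group F)"
      by (rule homI) (auto simp: restriction_group_carrier restriction_group_mult \<phi> u_add)
    show "(\<phi> ^^ idx L) f = f" if "f \<in> carrier (restriction_group F)" for f
      using that triv[OF idx_multiple_mem[OF L, of m]] by (auto simp: restriction_group_carrier pow)
    show "restriction F b \<in> carrier (restriction_group F)" by (simp add: restriction_group_carrier)
    show "restriction F b [^]\<^bsub>restriction_group F\<^esub> (p ^ k) = \<one>\<^bsub>restriction_group F\<^esub>" by (simp only: restriction_group_pow b(2) restriction_group_one)
    show "\<phi> (restriction F b) \<noteq> restriction F b"
    proof
      assume "\<phi> (restriction F b) = restriction F b"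
      then have "\<phi> (restriction F b) x = restriction F b x" by simp
      then have "b \<in> Z" using xF inv[OF xF] by (simp add: \<phi>_def restriction_def Z_def)
      then show False using b(3) by blast
    qed
    show "p \<noteq> idx L" using pP q(2) by blast
  qed (use q b in auto)
  then obtain e where "e > 0" "p ^ e \<le> card (carrier (restriction_group F))" "[p ^ e = 1] (mod idx L)" by blast
  then show ?thesis using card pP by (auto simp: restriction_group_carrier intro: order.trans)
qed

lemma dual_growth:
  assumes noeth: "noetherian \<alpha>" and ent: "entropy_rank_one \<alpha>"
  obtains S N C where "\<And>R. finite (box S R) \<and> card (box S R) \<le> N ^ (C * (R + 1))" "N > (0::nat)" "gen S = UNIV"
proof -
  obtain S where S: "finite S" "gen S = UNIV"
    using acc_finitely_generated[OF acc_if_noetherian[OF noeth]] by blast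
  have "\<forall>a. \<exists>n>0. zmul (int n) (a :: 'x pdual) = 0" using pdual_torsion[OF comp zd] by blast
  then obtain o' where o': "\<And>a :: 'x pdual. o' a > 0" "\<And>a. zmul (int (o' a)) (a :: 'x pdual) = 0" by metis
  \<comment> \<open>A common exponent for all generators, which serves as modulus for every
    coefficient.\<close>
  define N where "N = (\<Prod>a\<in>S. o' a)"
  have N: "N > 0" using o'(1) by (simp add: N_def prod_pos)
  have kill: "zmul (int N) a = 0" if "a \<in> S" for a
  proof -
    have "o' a dvd N" unfolding N_def using that S(1) by (rule dvd_prodI[rotated])
    then obtain t where "N = t * o' a" by (metis dvd_def mult.commute)
    then show ?thesis by (simp only: of_nat_mult zmul_mult o'(2)) simp
  qed
  have "\<exists>C. \<forall>R. finite (box S R) \<and> card (box S R) \<le> N ^ (C * (R + 1))"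
  proof (rule box_linear_growth[OF _ S(1) N kill])
    show "\<exists>m. (\<forall>k. k \<noteq> i \<and> k \<noteq> j \<longrightarrow> m k = 0) \<and> reducible m a" if "i \<noteq> j" for a i j
      by (rule reducible_exists[OF prime_torsion_reducible[OF ent _ _ that] o'])
  qed
  then show thesis using that N S(2) by blast
qed

end

theorem theorem2p9:
  fixes \<alpha> :: "('d::finite \<Rightarrow> int) \<Rightarrow> 'x::{metric_space, ab_group_add, topological_group_add} \<Rightarrow> 'x"
    and \<mu> :: "'x measure"
  assumes "CARD('d) \<ge> 2"
    and "compact (UNIV :: 'x set)"
    and "zero_dimensional TYPE('x)"
    and "zd_action \<alpha>"
    and "by_cont_automorphisms \<alpha>"
    and "haar_measure \<mu>"
    and "mixing \<mu> \<alpha>"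
    and "noetherian \<alpha>"
    and "entropy_rank_one \<alpha>"
  shows "\<forall>\<epsilon>>0. finite (fixcount \<alpha> ` Ld_P_eps (primes_of \<alpha>) \<epsilon>)"
proof (intro allI impI)
  fix \<epsilon> :: real assume \<epsilon>: "\<epsilon> > 0"
  interpret zd_system \<alpha> by unfold_locales (rule assms)+
  obtain S N C where growth: "\<And>R. finite (box S R) \<and> card (box S R) \<le> N ^ (C * (R + 1))"
    and N: "N > (0::nat)" and gen: "gen S = UNIV"
    using dual_growth[OF assms(8,9)] by blast
  let ?d = "real CARD('d)"
  \<comment> \<open>Beyond this index q^\<epsilon> is at least N C + 1, whereas a moved point would
    give q^\<epsilon> < N C.\<close>
  define Q where "Q = nat \<lceil>real (N * C + 1) powr (1 / \<epsilon>)\<rceil>"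
  have fixed: "{x. \<forall>n\<in>L. \<alpha> n x = x} = {x. \<forall>n. \<alpha> n x = x}"
    if L: "L \<in> Ld_P_eps (primes_of \<alpha>) \<epsilon>" and large: "Q < idx L" for L
  proof (rule ccontr)
    define q where "q = idx L"
    have L': "L \<in> finite_index_subgroups" "prime q" "q \<notin> primes_of \<alpha>"
      and ord: "\<And>p. p \<in> primes_of \<alpha> \<Longrightarrow> real (ord q p) > real q powr (1 / ?d + \<epsilon>)"
      using L by (auto simp: Ld_P_eps_def q_def)
    have q0: "real q > 0" using prime_gt_0_nat[OF L'(2)] by simp
    assume "\<not> ?thesis"
    then obtain x m where x: "\<And>n. n \<in> L \<Longrightarrow> \<alpha> n x = x" "\<alpha> m x \<noteq> x" by blast
    \<comment> \<open>The integer part of q^(1/d) satisfies q < (s + 1)^d, the pigeonhole condition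
      for a short vector.\<close>
    define s where "s = nat \<lfloor>real q powr (1 / ?d)\<rfloor>"
    have s_le: "real s \<le> real q powr (1 / ?d)" by (simp add: s_def)
    have "real q = (real q powr (1 / ?d)) ^ CARD('d)"
      using q0 by (simp add: powr_realpow[symmetric] powr_powr)
    also have "\<dots> < real (s + 1) ^ CARD('d)"
    proof (rule power_strict_mono)
      show "real q powr (1 / ?d) < real (s + 1)" unfolding s_def by linarith
    qed auto
    finally have "real q < real ((s + 1) ^ CARD('d))" by simp
    then have s: "idx L < (s + 1) ^ CARD('d)" by (simp only: of_nat_less_iff q_def)
    have "\<exists>p\<in>primes_of \<alpha>. \<exists>e>0. p ^ e \<le> N ^ (C * s) \<and> [p ^ e = 1] (mod idx L)"
      by (rule nonfixed_point_bound[OF growth N gen assms(8) _ L'(1) L'(2,3)[unfolded q_def] s x])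
        (rule mixing_no_fixed_character[OF assms(6,7)])
    then obtain p e where p: "p \<in> primes_of \<alpha>" and e: "e > 0" "p ^ e \<le> N ^ (C * s)" "[p ^ e = 1] (mod q)"
      unfolding q_def by blast
    \<comment> \<open>Bounding the left side below and the right side above by powers of 2 gives a
      linear bound on \<open>e\<close> that is uniform in \<open>p\<close>.\<close>
    have "(2::nat) ^ e \<le> p ^ e"
      using p prime_ge_2_nat by (intro power_mono) (auto simp: primes_of_def)
    also have "\<dots> \<le> N ^ (C * s)" by (rule e)
    also have "\<dots> \<le> (2 ^ N) ^ (C * s)" by (intro power_mono) (auto simp: less_imp_le)
    finally have "(2::nat) ^ e \<le> 2 ^ (N * (C * s))" by (simp only: power_mult)
    then have "e \<le> N * (C * s)" by simp
    moreover have "ord q p \<le> e" using e(1,3) ord_divides[of p e q] by (auto intro: dvd_imp_le)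
    ultimately have "ord q p \<le> N * C * s" by (simp add: mult.assoc)
    then have "real (ord q p) \<le> real (N * C) * real s" by (metis of_nat_le_iff of_nat_mult)
    also have "\<dots> \<le> real (N * C) * real q powr (1 / ?d)" by (intro mult_left_mono s_le) auto
    finally have "real q powr (1 / ?d) * real q powr \<epsilon> < real q powr (1 / ?d) * real (N * C)"
      using ord[OF p] by (simp add: powr_add mult.commute)
    then have small: "real q powr \<epsilon> < real (N * C)" using q0 by simp
    have "real (N * C + 1) powr (1 / \<epsilon>) \<le> real q" using large unfolding Q_def q_def by linarith
    then have "(real (N * C + 1) powr (1 / \<epsilon>)) powr \<epsilon> \<le> real q powr \<epsilon>"
      using \<epsilon> by (intro powr_mono2) auto
    then have "real (N * C + 1) \<le> real q powr \<epsilon>" using \<epsilon> by (simp add: powr_powr)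
    then show False using small by simp
  qed
  \<comment> \<open>The common value for all large indices: there the fixed sets themselves
    coincide. The finitely many subgroups of index at most \<open>Q\<close> contribute the other
    values.\<close>
  define c where "c = (let F = {x. \<forall>n. \<alpha> n x = x} in if finite F then enat (card F) else \<infinity>)"
  have *: "fixcount \<alpha> L = c" if "L \<in> Ld_P_eps (primes_of \<alpha>) \<epsilon>" "Q < idx L" for L
    unfolding fixcount_def c_def using fixed[OF that] by simp
  have "fixcount \<alpha> ` Ld_P_eps (primes_of \<alpha>) \<epsilon>
      \<subseteq> insert c (fixcount \<alpha> ` {L. L \<in> finite_index_subgroups \<and> idx L \<le> Q})"
  proof (intro image_subsetI)
    fix L :: "('d \<Rightarrow> int) set" assume L: "L \<in> Ld_P_eps (primes_of \<alpha>) \<epsilon>"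
    show "fixcount \<alpha> L \<in> insert c (fixcount \<alpha> ` {L. L \<in> finite_index_subgroups \<and> idx L \<le> Q})"
    proof (cases "Q < idx L")
      case False
      then show ?thesis using L by (auto simp: Ld_P_eps_def)
    qed (use L * in blast)
  qed
  then show "finite (fixcount \<alpha> ` Ld_P_eps (primes_of \<alpha>) \<epsilon>)"
    using finite_bounded_index[of Q] by (auto intro: finite_subset)
qed

end
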